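(* Let $f\in\Pi(M,M^n)$ and assume that $(M^n)\rightarrow(M)$. Consider the following three (equivalent) properties: (i) $X_T^n$ is $(B^n,f)$-UI; (ii) there exists $\tilde g(n)\to 0$ such that $V^f_{n,Q_n}=V^f_Q+O(\tilde g(n))$; (iii) there exists $\tilde g(n)\to 0$ such that $\sup_n\left|\int_0^\infty f'(a)(V^D_{n,Q_n}(a)-V^D_Q(a))\tilde g(n)^{-1}\,\mathrm da\right|<\infty$. Then: (1) if there exists $\tilde g(n)\to0$ as $n\to\infty$ such that $$h(a):=\sup_n\left|f'(a)\left(V^D_{n,Q_n}(a)-V^D_Q(a)\right)\tilde g(n)^{-1}\right|\in L^1(\mathbb R_+),$$ then (i), (ii) and (iii) hold; (2) if there exist a set $\Upsilon$ of Lebesgue measure zero, a function $h\in L^1(\mathbb R_+)$ and $\tilde g(n)\to0$ as $n\to\infty$ such that $$\sup_n\sup_{a\in\mathbb R_+\setminus\Upsilon}\left|[h(a)]^{-1}f'(a)\left(V^D_{n,Q_n}(a)-V^D_Q(a)\right)\tilde g(n)^{-1}\right|<\infty,$$ then (i), (ii) and (iii) hold. Here $\tilde g(n)$, and $h$ off $\Upsilon$, are nonvanishing wherever their inverses appear.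
   Context: Fix a maturity $T>0$ and write $\mathbb{R}_+=[0,\infty)$. Markets. A market is a six-tuple $(\Omega,\mathcal F,B,S,(\mathcal F_t),\mathbb P)$, where $B$ is the bond process, which is increasing, adapted and satisfies $B_0=1$, and $(\mathcal F_t)$ is the filtration generated by the stock process $S$. An underlying asset $X$ is a process $X_t$ adapted to $(\mathcal F_t)$, with $X_T$ taking values in $\mathbb{R}_+$. The set of equivalent martingale measures is assumed nonempty and one such measure $Q$ is fixed (the model need not be complete). Prices are $V_Q^f=\mathbb E_Q[B_T^{-1}f(X_T)]$, $V_Q^D(a)=\mathbb E_Q[B_T^{-1}\mathbf 1_{X_T>a}]$ and $V_Q^C(a)=\mathbb E_Q[B_T^{-1}(X_T-a)^+]$. The original model $(M)$ is such a market with chosen $Q$ and underlying $X_T$. The approximating models $(M^n)$ are markets $(\Omega^n,\mathcal F^n,B^n,S^n,(\mathcal F^n_t),\mathbb P^n)$ with chosen equivalent martingale measures $Q_n$ and underlying assets $X_T^n$. Prices in $(M^n)$ are denoted $V^f_{n,Q_n}=\mathbb E_{Q_n}[(B^n_T)^{-1}f(X^n_T)]$ and $V^D_{n,Q_n}(a)=\mathbb E_{Q_n}[(B^n_T)^{-1}\mathbf 1_{X^n_T>a}]$. Convergence of models. $(M^n)\to(M)$ means that there is a function $g$ with $g(n)\to0$ such that $V^D_{n,Q_n}(a)=V^D_Q(a)+O(g(n))$ for every continuity point $a$ of $V^D_Q$, and $\mathbb E_{Q_n}[(B^n_T)^{-1}]=\mathbb E_Q[B_T^{-1}]+O(g(n))$.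 Payoff classes. $f:\mathbb R_+\to\mathbb R$ belongs to $\Pi$ if $f$ is continuously differentiable except on a finite set of points $0<s_1<\dots<s_N$ (and possibly at $s_0=0$), at which $f$ and $f'$ have jump discontinuities. By convention $\Delta_-f(0)=f(0-)=f'(0-)=0$. Further, $f\in\Pi_Q(X_T)$ if $f\in\Pi$, $f(X_T)\in L^1(Q)$, $\lim_{x\to\infty}|f(x-)|\,Q(X_T\ge x)=0$, and the Riemann–Stieltjes integral $\int_0^\infty f'(a)\,V_Q^C(\mathrm da)$ exists. Finally, $f\in\Pi(M,M^n)$ means that $f\in\Pi_Q(X_T)\cap\bigcap_n\Pi_{Q_n}(X_T^n)$ and that $V_Q^D$ and $f$ have no common jump points. Uniform integrability. For $f\in\bigcap_n\Pi_{Q_n}(X^n_T)$, $X^n_T$ is uniformly integrable with respect to the pair $(B^n,f)$, or $(B^n,f)$-UI, if for every $\epsilon>0$ there is a number $a$ such that $\sup_n\left|\mathbb E_{Q_n}[(B^n_T)^{-1}f(X^n_T)\mathbf 1_{X^n_T>a}]\right|<\epsilon$. *)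

theory Defs
  imports "HOL-Probability.Probability" "HOL-Library.Landau_Symbols"
begin

section \<open>Markets\<close>

text \<open>
  A model bundles a market with the chosen equivalent martingale measure and the chosen underlying.
  The filtration is not a field since it is generated by the stock (\<open>model_filtration\<close>).
  Time is real-valued; only times in \<open>{0..T}\<close> are constrained or used.
\<close>

record 'a model =
  phys_measure :: "'a measure"
  bond :: "real \<Rightarrow> 'a \<Rightarrow> real"
  stock :: "real \<Rightarrow> 'a \<Rightarrow> real"
  pricing_measure :: "'a measure"
  underlying :: "real \<Rightarrow> 'a \<Rightarrow> real"

definition natural_filtration :: "'a set \<Rightarrow> (real \<Rightarrow> 'a \<Rightarrow> real) \<Rightarrow> real \<Rightarrow> 'a measure" where
  "natural_filtration \<Omega> S t = sigma \<Omega> (\<Union>s\<in>{0..t}. {S s -` A \<inter> \<Omega> | A. A \<in> sets borel})"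

abbreviation model_filtration :: "'a model \<Rightarrow> real \<Rightarrow> 'a measure" where
  "model_filtration M \<equiv> natural_filtration (space (phys_measure M)) (stock M)"

definition adapted_upto :: "real \<Rightarrow> (real \<Rightarrow> 'a measure) \<Rightarrow> (real \<Rightarrow> 'a \<Rightarrow> real) \<Rightarrow> bool" where
  "adapted_upto T F Y \<longleftrightarrow> (\<forall>t\<in>{0..T}. Y t \<in> borel_measurable (F t))"

definition martingale_upto ::
  "real \<Rightarrow> 'a measure \<Rightarrow> (real \<Rightarrow> 'a measure) \<Rightarrow> (real \<Rightarrow> 'a \<Rightarrow> real) \<Rightarrow> bool" where
  "martingale_upto T Q F Y \<longleftrightarrow>
     adapted_upto T F Y \<and> (\<forall>t\<in>{0..T}. integrable Q (Y t)) \<and>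
     (\<forall>s t. 0 \<le> s \<and> s \<le> t \<and> t \<le> T \<longrightarrow> (AE \<omega> in Q. real_cond_exp Q (F s) (Y t) \<omega> = Y s \<omega>))"

definition equivalent_martingale_measure :: "real \<Rightarrow> 'a model \<Rightarrow> 'a measure \<Rightarrow> bool" where
  "equivalent_martingale_measure T M Q \<longleftrightarrow>
     prob_space Q \<and> sets Q = sets (phys_measure M) \<and>
     absolutely_continuous (phys_measure M) Q \<and> absolutely_continuous Q (phys_measure M) \<and>
     martingale_upto T Q (model_filtration M) (\<lambda>t \<omega>. stock M t \<omega> / bond M t \<omega>)"

definition is_model :: "real \<Rightarrow> 'a model \<Rightarrow> bool" where
  "is_model T M \<longleftrightarrow>
     prob_space (phys_measure M) \<and>
     (\<forall>t\<in>{0..T}. stock M t \<in> borel_measurable (phys_measure M)) \<and>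
     adapted_upto T (model_filtration M) (bond M) \<and>
     (\<forall>\<omega>\<in>space (phys_measure M). bond M 0 \<omega> = 1 \<and> mono_on {0..T} (\<lambda>t. bond M t \<omega>)) \<and>
     equivalent_martingale_measure T M (pricing_measure M) \<and>
     adapted_upto T (model_filtration M) (underlying M) \<and>
     (\<forall>\<omega>\<in>space (phys_measure M). 0 \<le> underlying M T \<omega>)"

section \<open>Prices\<close>

definition expect_discounted :: "real \<Rightarrow> 'a model \<Rightarrow> (real \<Rightarrow> real) \<Rightarrow> real" where
  "expect_discounted T M f =
     (\<integral>\<omega>. inverse (bond M T \<omega>) * f (underlying M T \<omega>) \<partial>pricing_measure M)"

abbreviation payoff_price :: "real \<Rightarrow> 'a model \<Rightarrow> (real \<Rightarrow> real) \<Rightarrow> real" where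
  "payoff_price T M f \<equiv> expect_discounted T M f"

definition digital_price :: "real \<Rightarrow> 'a model \<Rightarrow> real \<Rightarrow> real" where
  "digital_price T M a = expect_discounted T M (indicator {a<..})"

definition call_price :: "real \<Rightarrow> 'a model \<Rightarrow> real \<Rightarrow> real" where
  "call_price T M a = expect_discounted T M (\<lambda>x. max (x - a) 0)"

definition bond_price :: "real \<Rightarrow> 'a model \<Rightarrow> real" where
  "bond_price T M = expect_discounted T M (\<lambda>_. 1)"

section \<open>Convergence of models\<close>

text \<open>
  The constant in the O-term may depend on the strike.  \<open>digital_price\<close> is defined on all of the
  reals and equals the bond price at negative strikes, so \<open>0\<close> is a continuity point iff the
  underlying has no atom at \<open>0\<close>.
\<close>

definition models_converge :: "real \<Rightarrow> (nat \<Rightarrow> 'b model) \<Rightarrow> 'a model \<Rightarrow> bool" where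
  "models_converge T Mn M \<longleftrightarrow>
     (\<exists>g :: nat \<Rightarrow> real. g \<longlonglongrightarrow> 0 \<and>
        (\<forall>a\<ge>0. isCont (digital_price T M) a \<longrightarrow>
            (\<lambda>n. digital_price T (Mn n) a - digital_price T M a) \<in> O(g)) \<and>
        (\<lambda>n. bond_price T (Mn n) - bond_price T M) \<in> O(g))"

section \<open>Payoff classes\<close>

text \<open>
  A payoff on \<open>[0,\<infinity>)\<close> is a total function whose values at negative arguments are never used;
  hence all derivatives are taken within \<open>{0..}\<close>, giving the right derivative at \<open>0\<close>.
  At the finitely many exceptional points the value of \<open>payoff_deriv\<close> is unspecified.
\<close>

definition payoff_deriv :: "(real \<Rightarrow> real) \<Rightarrow> real \<Rightarrow> real" where
  "payoff_deriv f a = vector_derivative f (at a within {0..})"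

definition payoff_class :: "(real \<Rightarrow> real) set" where
  "payoff_class = {f. \<exists>P. finite P \<and> P \<subseteq> {0..} \<and>
     (\<forall>a\<in>{0..} - P. f differentiable (at a within {0..})) \<and>
     continuous_on ({0..} - P) (payoff_deriv f) \<and>
     (\<forall>s\<in>P. (\<exists>l. (f \<longlongrightarrow> l) (at_right s)) \<and> (\<exists>l. (payoff_deriv f \<longlongrightarrow> l) (at_right s))) \<and>
     (\<forall>s\<in>P - {0}. (\<exists>l. (f \<longlongrightarrow> l) (at_left s)) \<and> (\<exists>l. (payoff_deriv f \<longlongrightarrow> l) (at_left s)))}"

text \<open>
  The Riemann--Stieltjes integral of \<open>\<phi>\<close> with respect to \<open>G\<close> over \<open>[a,b]\<close>: requiring the division
  to be fine for the constant gauge \<open>ball x \<delta>\<close> amounts to bounding its mesh.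
\<close>

definition has_RS_integral ::
  "(real \<Rightarrow> real) \<Rightarrow> (real \<Rightarrow> real) \<Rightarrow> real \<Rightarrow> real \<Rightarrow> real \<Rightarrow> bool" where
  "has_RS_integral \<phi> G a b I \<longleftrightarrow>
     (\<forall>\<epsilon>>0. \<exists>\<delta>>0. \<forall>p. p tagged_division_of {a..b} \<and> (\<lambda>x. ball x \<delta>) fine p \<longrightarrow>
        \<bar>(\<Sum>(x, K)\<in>p. \<phi> x * (G (Sup K) - G (Inf K))) - I\<bar> < \<epsilon>)"

definition RS_integral_to_infinity_exists :: "(real \<Rightarrow> real) \<Rightarrow> (real \<Rightarrow> real) \<Rightarrow> bool" where
  "RS_integral_to_infinity_exists \<phi> G \<longleftrightarrow>
     (\<exists>J I. (\<forall>b\<ge>0. has_RS_integral \<phi> G 0 b (J b)) \<and> (J \<longlongrightarrow> I) at_top)"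

text \<open>
  The integrability of the discounted call payoffs says that the integrator \<open>call_price T M\<close> is
  finite; without it the Bochner integral would default to \<open>0\<close> and the Stieltjes condition
  would be void.
\<close>

definition payoff_class_wrt :: "real \<Rightarrow> 'a model \<Rightarrow> (real \<Rightarrow> real) set" where
  "payoff_class_wrt T M = {f \<in> payoff_class.
     integrable (pricing_measure M) (\<lambda>\<omega>. f (underlying M T \<omega>)) \<and>
     ((\<lambda>x. \<bar>Lim (at_left x) f\<bar> *
           measure (pricing_measure M) {\<omega> \<in> space (pricing_measure M). x \<le> underlying M T \<omega>})
        \<longlongrightarrow> 0) at_top \<and>
     (\<forall>a\<ge>0. integrable (pricing_measure M)
              (\<lambda>\<omega>. inverse (bond M T \<omega>) * max (underlying M T \<omega> - a) 0)) \<and>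
     RS_integral_to_infinity_exists (payoff_deriv f) (call_price T M)}"

definition payoff_class_models ::
  "real \<Rightarrow> 'a model \<Rightarrow> (nat \<Rightarrow> 'b model) \<Rightarrow> (real \<Rightarrow> real) set" where
  "payoff_class_models T M Mn = {f \<in> payoff_class_wrt T M \<inter> (\<Inter>n. payoff_class_wrt T (Mn n)).
     \<not> (\<exists>a\<ge>0. \<not> isCont (digital_price T M) a \<and> \<not> continuous (at a within {0..}) f)}"

section \<open>The three properties\<close>

definition uniformly_integrable_wrt ::
  "real \<Rightarrow> (nat \<Rightarrow> 'b model) \<Rightarrow> (real \<Rightarrow> real) \<Rightarrow> bool" where
  "uniformly_integrable_wrt T Mn f \<longleftrightarrow>
     (\<forall>\<epsilon>>0. \<exists>a::real.
        (SUP n. ereal \<bar>expect_discounted T (Mn n) (\<lambda>x. f x * indicator {a<..} x)\<bar>) < ereal \<epsilon>)"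

definition payoff_prices_converge ::
  "real \<Rightarrow> 'a model \<Rightarrow> (nat \<Rightarrow> 'b model) \<Rightarrow> (real \<Rightarrow> real) \<Rightarrow> bool" where
  "payoff_prices_converge T M Mn f \<longleftrightarrow>
     (\<exists>g :: nat \<Rightarrow> real. g \<longlonglongrightarrow> 0 \<and>
        (\<lambda>n. payoff_price T (Mn n) f - payoff_price T M f) \<in> O(g))"

text \<open>
  The integral over \<open>[0,\<infinity>)\<close> may converge only conditionally; the Henstock--Kurzweil integral over
  \<open>{0..}\<close> covers such improper integrals.  Its existence is part of the property.
\<close>

definition scaled_error_integrals_bounded ::
  "real \<Rightarrow> 'a model \<Rightarrow> (nat \<Rightarrow> 'b model) \<Rightarrow> (real \<Rightarrow> real) \<Rightarrow> bool" where
  "scaled_error_integrals_bounded T M Mn f \<longleftrightarrow>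
     (\<exists>g :: nat \<Rightarrow> real. g \<longlonglongrightarrow> 0 \<and> (\<forall>n. g n \<noteq> 0) \<and>
        (let \<phi> = (\<lambda>n a. payoff_deriv f a * (digital_price T (Mn n) a - digital_price T M a)
                        * inverse (g n))
         in (\<forall>n. \<phi> n integrable_on {0..}) \<and>
            (SUP n. ereal \<bar>integral {0..} (\<phi> n)\<bar>) < \<infinity>))"

section \<open>Integrability on the half-line\<close>

text \<open>
  For the pointwise supremum of a sequence of absolute values, which may be infinite on a
  null set.
\<close>

definition L1_halfline :: "(real \<Rightarrow> ennreal) \<Rightarrow> bool" where
  "L1_halfline h \<longleftrightarrow>
     h \<in> borel_measurable (restrict_space lebesgue {0..}) \<and>
     (\<integral>\<^sup>+a\<in>{0..}. h a \<partial>lebesgue) < \<infinity>"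

end

theory Submission
  imports Defs
begin

text \<open>
  Prices are integrals against the discounted law \<open>\<mu>(A) = E\<^sub>Q[B\<^sub>T\<^sup>-\<^sup>1 1\<^bsub>X\<^sub>T \<in> A\<^esub>]\<close>, whose tail function is
  the digital price.  Where \<open>f\<close> is smooth on \<open>[a,\<infinity>)\<close>, integration by parts gives
  \<open>\<integral>\<^bsub>x>a\<^esub> f d\<mu> = f(a) \<mu>(a,\<infinity>) + \<integral>\<^bsub>[a,\<infinity>)\<^esub> f'(u) \<mu>(u,\<infinity>) du\<close>, the last integral being improper.  Subtracting
  this identity for two models, the domination hypothesis makes the difference of the integrals
  at most \<open>\<bar>g(n)\<bar>\<close> times the tail integral of an integrable function.  This yields the convergence of the part of
  the price beyond a continuity point \<open>a\<close> of the digital price; on \<open>[0,a]\<close> the payoff is bounded and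
  continuous off the atoms of \<open>\<mu>\<close>, so weak convergence applies.  No rate is claimed in (ii), hence
  jumps of \<open>f\<close> need no separate treatment.
\<close>

section \<open>Tails of finite Borel measures\<close>

text \<open>The half-line is open so that, for the discounted law of a model, this is exactly the
  digital price.\<close>

definition tail :: "real measure \<Rightarrow> real \<Rightarrow> real" where
  "tail M a = measure M {a<..}"

context finite_borel_measure
begin

lemma tail_eq_cdf: "tail M a = measure M UNIV - cdf M a"
proof -
  have "{a<..} = space M - {..a}" by (auto simp: borel_UNIV)
  then have "tail M a = measure M (space M) - measure M {..a}"
    unfolding tail_def by (simp add: finite_measure_compl sets_M)
  then show ?thesis by (simp add: cdf_def borel_UNIV)
qed

lemma tail_nonneg: "0 \<le> tail M a"
  by (simp add: tail_def)

lemma tail_le_total: "tail M a \<le> measure M UNIV"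
  using bounded_measure[of "{a<..}"] by (simp add: tail_def borel_UNIV)

lemma tail_antimono: "a \<le> b \<Longrightarrow> tail M b \<le> tail M a"
  by (simp add: tail_eq_cdf cdf_nondecreasing)

lemma tail_tendsto_0: "(tail M \<longlongrightarrow> 0) at_top"
proof -
  have "((\<lambda>a. measure M UNIV - cdf M a) \<longlongrightarrow> measure M UNIV - measure M UNIV) at_top"
    using cdf_lim_at_top by (intro tendsto_intros) (simp add: borel_UNIV)
  then show ?thesis by (simp add: tail_eq_cdf[abs_def])
qed

lemma borel_measurable_tail: "tail M \<in> borel_measurable borel"
proof -
  have "mono (cdf M)" by (simp add: mono_def cdf_nondecreasing)
  then have "cdf M \<in> borel_measurable borel" by (rule borel_measurable_mono)
  then show ?thesis by (simp add: tail_eq_cdf[abs_def])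
qed

lemma isCont_tail: "isCont (tail M) a \<longleftrightarrow> isCont (cdf M) a"
proof
  assume "isCont (tail M) a"
  then have "isCont (\<lambda>x. measure M UNIV - tail M x) a" by (intro continuous_intros)
  then show "isCont (cdf M) a" by (simp add: tail_eq_cdf)
next
  assume "isCont (cdf M) a"
  then have "isCont (\<lambda>x. measure M UNIV - cdf M x) a" by (intro continuous_intros)
  then show "isCont (tail M) a" by (simp add: tail_eq_cdf[abs_def])
qed

lemma isCont_tail_iff_no_atom: "isCont (tail M) a \<longleftrightarrow> measure M {a} = 0"
  by (simp add: isCont_tail isCont_cdf)

text \<open>The tail jumps only at atoms, and a finite measure has countably many. Strikes at which
  prices are known to converge are chosen with this.\<close>

lemma ex_continuity_point_tail:
  assumes "a < b"
  shows "\<exists>x>a. x < b \<and> isCont (tail M) x"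
proof (rule ccontr)
  assume "\<not> ?thesis"
  then have "{a<..<b} \<subseteq> {x. measure M {x} > 0}"
    by (auto simp: isCont_tail_iff_no_atom zero_less_measure_iff)
  then have "countable {a<..<b}" using countable_atoms countable_subset by blast
  then show False using assms uncountable_open_interval by blast
qed

text \<open>For \<open>x > a\<close>, \<open>F (min x b) - F a\<close> is the integral of
  \<open>F'\<close> over the \<open>u\<close> in \<open>{a..b}\<close> with \<open>u < x\<close>.
  Swapping it with the integral over \<open>x\<close> leaves \<open>tail M u\<close> inside. Capping
  the argument at \<open>b\<close> keeps the integrand bounded, so Fubini applies.\<close>

lemma integral_min_tail:
  fixes F F' :: "real \<Rightarrow> real"
  assumes ab: "a \<le> b"
    and deriv: "\<And>u. a \<le> u \<Longrightarrow> u \<le> b \<Longrightarrow> (F has_real_derivative F' u) (at u)"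
    and cont: "continuous_on {a..b} F'"
  shows "(\<integral>x. indicator {a<..} x * F (min x b) \<partial>M)
       = F a * tail M a + (\<integral>u. indicator {a..b} u * (F' u * tail M u) \<partial>lborel)"
proof -
  have [measurable_cong]: "sets M = sets borel" by (rule M_is_borel)
  interpret P: pair_sigma_finite lborel M
    by (intro pair_sigma_finite.intro sigma_finite_lborel sigma_finite_measure_axioms)
  define G where "G u = indicator {a..b} u * F' u" for u
  have G_int: "integrable lborel G"
    using borel_integrable_compact[OF compact_Icc cont]
    by (simp add: G_def[abs_def] indicator_times_eq_if cong: if_cong)
  have G_meas [measurable]: "G \<in> borel_measurable borel"
    using borel_measurable_integrable[OF G_int] by simp
  note [measurable] = borel_measurable_tail
  have rect: "(\<lambda>p::real\<times>real. indicator {fst p<..} (snd p) :: real) \<in> borel_measurable (lborel \<Otimes>\<^sub>M M)"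
  proof -
    have "(\<lambda>p::real\<times>real. indicator {p. fst p < snd p} p :: real) \<in> borel_measurable (lborel \<Otimes>\<^sub>M M)"
      by measurable
    then show ?thesis by (simp add: indicator_def)
  qed
  have meas: "(\<lambda>(u,x). G u * indicator {u<..} x) \<in> borel_measurable (lborel \<Otimes>\<^sub>M M)"
    using rect by (simp add: case_prod_beta)
  have int_pair: "integrable (lborel \<Otimes>\<^sub>M M) (\<lambda>(u,x). G u * indicator {u<..} x)"
  proof (rule P.Fubini_integrable[OF meas])
    have "(\<lambda>u. \<integral>x. norm (G u * indicator {u<..} x) \<partial>M) = (\<lambda>u. \<bar>G u\<bar> * tail M u)"
      by (simp add: abs_mult tail_def borel_UNIV)
    moreover have "integrable lborel (\<lambda>u. \<bar>G u\<bar> * tail M u)"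
    proof (rule Bochner_Integration.integrable_bound)
      show "integrable lborel (\<lambda>u. G u * measure M UNIV)" using G_int by simp
      show "AE u in lborel. norm (\<bar>G u\<bar> * tail M u) \<le> norm (G u * measure M UNIV)"
        using tail_nonneg tail_le_total by (auto simp: abs_mult intro!: mult_left_mono)
    qed measurable
    ultimately show "integrable lborel (\<lambda>u. \<integral>x. norm (case (u, x) of (u, x) \<Rightarrow> G u * indicator {u<..} x) \<partial>M)"
      by simp
    show "AE u in lborel. integrable M (\<lambda>x. case (u, x) of (u, x) \<Rightarrow> G u * indicator {u<..} x)"
      by (auto intro!: integrable_real_indicator simp: less_top[symmetric])
  qed
  have outer: "(\<integral>u. G u * indicator {u<..} x \<partial>lborel) = indicator {a<..} x * (F (min x b) - F a)" for x
  proof (cases "a < x")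
    case True
    have "(\<integral>u. G u * indicator {u<..} x \<partial>lborel) = (\<integral>u. indicator {a..min x b} u *\<^sub>R F' u \<partial>lborel)"
    proof (rule integral_cong_AE)
      \<comment> \<open>Within \<open>{a..b}\<close>, \<open>u < x\<close> and
        \<open>u \<le> min x b\<close> disagree at most at \<open>u = x\<close>.\<close>
      show "AE u in lborel. G u * indicator {u<..} x = indicator {a..min x b} u *\<^sub>R F' u"
        using AE_lborel_singleton[of x] by eventually_elim (auto simp: G_def indicator_def)
      have "(\<lambda>u. indicator {a..min x b} u *\<^sub>R F' u) = (\<lambda>u. indicator {a..min x b} u * G u)"
        by (auto simp: G_def indicator_def)
      then show "(\<lambda>u. indicator {a..min x b} u *\<^sub>R F' u) \<in> borel_measurable lborel" by simp
      have "(\<lambda>u. indicator {u<..} x) = (indicator {..<x} :: real \<Rightarrow> real)"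
        by (auto simp: indicator_def)
      then show "(\<lambda>u. G u * indicator {u<..} x) \<in> borel_measurable lborel"
        by (simp add: borel_measurable_times)
    qed
    also have "\<dots> = F (min x b) - F a"
    proof (rule integral_FTC_atLeastAtMost)
      show "a \<le> min x b" using True ab by simp
      show "continuous_on {a..min x b} F'" using cont by (rule continuous_on_subset) auto
      show "(F has_vector_derivative F' u) (at u within {a..min x b})" if "a \<le> u" "u \<le> min x b" for u
        using deriv[of u] that
        by (simp add: has_real_derivative_iff_has_vector_derivative has_vector_derivative_at_within)
    qed
    finally show ?thesis using True by simp
  next
    case False
    then have "(\<lambda>u. G u * indicator {u<..} x) = (\<lambda>u. 0)" by (auto simp: G_def indicator_def)
    then show ?thesis using False by simp
  qed
  have "(\<integral>x. indicator {a<..} x * (F (min x b) - F a) \<partial>M) = (\<integral>u. G u * tail M u \<partial>lborel)"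
    using P.Fubini_integral[OF int_pair] by (simp add: outer tail_def borel_UNIV)
  moreover have "integrable M (\<lambda>x. indicator {a<..} x * (F (min x b) - F a))"
    using P.integrable_snd[OF int_pair] by (simp add: outer)
  then have "(\<integral>x. indicator {a<..} x * (F (min x b) - F a) + indicator {a<..} x * F a \<partial>M)
      = (\<integral>x. indicator {a<..} x * (F (min x b) - F a) \<partial>M) + tail M a * F a"
    by (subst Bochner_Integration.integral_add) (auto simp: tail_def borel_UNIV intro!: integrable_mult_left integrable_real_indicator simp: less_top[symmetric])
  ultimately show ?thesis by (simp add: G_def algebra_simps)
qed

end

text \<open>The masses are normalised to bring the library's Skorohod-based theorem on laws into play.\<close>

lemma tendsto_integral_of_tails:
  fixes N :: "nat \<Rightarrow> real measure" and \<phi> :: "real \<Rightarrow> real"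
  assumes M: "finite_borel_measure M" and N: "\<And>n. finite_borel_measure (N n)"
    and M_pos: "0 < measure M UNIV" and N_pos: "\<And>n. 0 < measure (N n) UNIV"
    and total: "(\<lambda>n. measure (N n) UNIV) \<longlonglongrightarrow> measure M UNIV"
    and tails: "\<And>a. isCont (tail M) a \<Longrightarrow> (\<lambda>n. tail (N n) a) \<longlonglongrightarrow> tail M a"
    and \<phi>_meas: "\<phi> \<in> borel_measurable borel" and \<phi>_bdd: "\<And>x. \<bar>\<phi> x\<bar> \<le> C"
    and discont: "measure M {x. \<not> isCont \<phi> x} = 0"
  shows "(\<lambda>n. \<integral>x. \<phi> x \<partial>N n) \<longlonglongrightarrow> (\<integral>x. \<phi> x \<partial>M)"
proof -
  define nrm :: "real measure \<Rightarrow> real measure" where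
    "nrm K = density K (\<lambda>_. ennreal (1 / measure K UNIV))" for K
  have distribution: "real_distribution (nrm K)"
    and scale: "\<And>A. A \<in> sets borel \<Longrightarrow> measure (nrm K) A = measure K A / measure K UNIV"
    and integral: "(\<integral>x. \<phi> x \<partial>nrm K) = (\<integral>x. \<phi> x \<partial>K) / measure K UNIV"
    if "finite_borel_measure K" "0 < measure K UNIV" for K
  proof -
    interpret K: finite_borel_measure K by fact
    show sc: "measure (nrm K) A = measure K A / measure K UNIV" if "A \<in> sets borel" for A
      using that \<open>0 < measure K UNIV\<close> unfolding nrm_def
      by (subst measure_density_const) (auto simp: K.M_is_borel)
    have "measure (nrm K) (space (nrm K)) = 1"
      using sc[of UNIV] that by (simp add: nrm_def K.borel_UNIV)
    then have "prob_space (nrm K)"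
      by (intro prob_spaceI) (metis emeasure_eq_ennreal_measure ennreal_1 measure_eq_emeasure_eq_ennreal top.extremum_uniqueI measure_zero_top zero_neq_one)
    then show "real_distribution (nrm K)"
      by (simp add: real_distribution_def real_distribution_axioms_def nrm_def K.M_is_borel)
    have [measurable_cong]: "sets K = sets borel" by (rule K.M_is_borel)
    show "(\<integral>x. \<phi> x \<partial>nrm K) = (\<integral>x. \<phi> x \<partial>K) / measure K UNIV"
      using that \<phi>_meas unfolding nrm_def by (subst integral_density) auto
  qed
  interpret M: finite_borel_measure M by fact
  interpret N: finite_borel_measure "N n" for n by (rule N)
  have cdf_nrm: "cdf (nrm K) a = 1 - tail K a / measure K UNIV"
    if "finite_borel_measure K" "0 < measure K UNIV" for K a
    using that finite_borel_measure.tail_eq_cdf[OF that(1), of a]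
    by (simp add: cdf_def scale field_simps)
  have "weak_conv_m (\<lambda>n. nrm (N n)) (nrm M)"
    unfolding weak_conv_m_def weak_conv_def
  proof safe
    fix a assume "isCont (cdf (nrm M)) a"
    \<comment> \<open>Undoing the normalisation turns this function into \<open>tail M\<close>, so
      continuity of the normalised cdf carries over to the tail.\<close>
    then have "isCont (\<lambda>a. (1 - cdf (nrm M) a) * measure M UNIV) a" by (intro continuous_intros)
    then have "isCont (tail M) a" using M_pos by (simp add: cdf_nrm[OF M M_pos])
    then have "(\<lambda>n. 1 - tail (N n) a / measure (N n) UNIV) \<longlonglongrightarrow> 1 - tail M a / measure M UNIV"
      using M_pos total tails by (intro tendsto_intros) auto
    then show "(\<lambda>n. cdf (nrm (N n)) a) \<longlonglongrightarrow> cdf (nrm M) a"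
      by (simp add: cdf_nrm[OF M M_pos] cdf_nrm[OF N N_pos])
  qed
  moreover have "emeasure (nrm M) {x. \<not> isCont \<phi> x} = 0"
  proof -
    interpret nM: real_distribution "nrm M" by (rule distribution[OF M M_pos])
    \<comment> \<open>The set of continuity points of any real function is Borel, so
      \<open>scale\<close> applies to its complement.\<close>
    have "- {x. isCont \<phi> x} \<in> sets borel" by (intro borel_comp isCont_borel)
    then have "{x. \<not> isCont \<phi> x} \<in> sets borel" by (simp add: Collect_neg_eq)
    then show ?thesis using scale[OF M M_pos] discont by (simp add: nM.emeasure_eq_measure)
  qed
  ultimately have "(\<lambda>n. \<integral>x. \<phi> x \<partial>nrm (N n)) \<longlonglongrightarrow> (\<integral>x. \<phi> x \<partial>nrm M)"
    using \<phi>_meas \<phi>_bdd distribution[OF M M_pos] distribution[OF N N_pos]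
    by (intro weak_conv_imp_bdd_ae_continuous_conv[where B=C]) auto
  then have "(\<lambda>n. measure (N n) UNIV * (\<integral>x. \<phi> x \<partial>nrm (N n)))
      \<longlonglongrightarrow> measure M UNIV * (\<integral>x. \<phi> x \<partial>nrm M)"
    using total by (intro tendsto_intros)
  then show ?thesis
    using M_pos N_pos by (simp add: integral[OF M M_pos] integral[OF N N_pos] less_imp_neq[symmetric])
qed

section \<open>Improper integration by parts against a tail function\<close>

context finite_borel_measure
begin

lemma integral_beyond_tendsto_0:
  assumes "integrable M (\<lambda>x. indicator {r<..} x * F x :: real)"
  shows "((\<lambda>a. \<integral>x. indicator {a<..} x * F x \<partial>M) \<longlongrightarrow> 0) at_top"
proof -
  have [measurable_cong]: "sets M = sets borel" by (rule M_is_borel)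
  have [measurable]: "(\<lambda>x. indicator {r<..} x * F x) \<in> borel_measurable M"
    using assms by (rule borel_measurable_integrable)
  \<comment> \<open>Inserting \<open>indicator {r<..}\<close> yields an integrand dominated for
    every \<open>a\<close>; it changes nothing once \<open>r \<le> a\<close>.\<close>
  have "((\<lambda>a. \<integral>x. indicator {a<..} x * (indicator {r<..} x * F x) \<partial>M) \<longlongrightarrow> (\<integral>x. 0 \<partial>M)) at_top"
  proof (rule integral_dominated_convergence_at_top)
    show "integrable M (\<lambda>x. \<bar>indicator {r<..} x * F x\<bar>)" using assms by simp
    show "AE x in M. ((\<lambda>a. indicator {a<..} x * (indicator {r<..} x * F x)) \<longlongrightarrow> 0) at_top"
    proof (rule AE_I2)
      fix x
      have "eventually (\<lambda>a. indicator {a<..} x * (indicator {r<..} x * F x) = 0) at_top"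
        using eventually_ge_at_top[of x] by eventually_elim (auto simp: indicator_def)
      then show "((\<lambda>a. indicator {a<..} x * (indicator {r<..} x * F x)) \<longlongrightarrow> 0) at_top"
        by (rule tendsto_eventually)
    qed
    show "(\<lambda>x. indicator {a<..} x * (indicator {r<..} x * F x)) \<in> borel_measurable M" for a
      by measurable
  qed (auto simp: indicator_def)
  moreover have "eventually (\<lambda>a. (\<integral>x. indicator {a<..} x * (indicator {r<..} x * F x) \<partial>M)
      = (\<integral>x. indicator {a<..} x * F x \<partial>M)) at_top"
    using eventually_ge_at_top[of r]
    by eventually_elim (auto intro!: Bochner_Integration.integral_cong simp: indicator_def)
  ultimately show ?thesis by (simp add: tendsto_cong)
qed

text \<open>In \<open>integral_min_tail\<close> the capped integrand is \<open>F\<close> up to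
  \<open>b\<close> and the constant \<open>F b\<close> beyond. As \<open>b\<close> grows, the
  missing part of \<open>F\<close> vanishes by integrability and the boundary term at
  \<open>b\<close> by \<open>vanish\<close>. The limit is over bounded intervals because
  \<open>F' u * tail M u\<close> need not be absolutely integrable.\<close>

lemma integral_deriv_tail_tendsto:
  fixes F F' :: "real \<Rightarrow> real"
  assumes deriv: "\<And>u. a \<le> u \<Longrightarrow> (F has_real_derivative F' u) (at u)"
    and cont: "continuous_on {a..} F'"
    and int: "integrable M (\<lambda>x. indicator {a<..} x * F x)"
    and vanish: "((\<lambda>b. F b * tail M b) \<longlongrightarrow> 0) at_top"
  shows "((\<lambda>b. \<integral>u. indicator {a..b} u * (F' u * tail M u) \<partial>lborel)
          \<longlongrightarrow> (\<integral>x. indicator {a<..} x * F x \<partial>M) - F a * tail M a) at_top"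
proof -
  have [measurable_cong]: "sets M = sets borel" by (rule M_is_borel)
  let ?E = "\<lambda>a. \<integral>x. indicator {a<..} x * F x \<partial>M"
  have "((\<lambda>b. ?E a - ?E b + F b * tail M b - F a * tail M a) \<longlongrightarrow> ?E a - 0 + 0 - F a * tail M a) at_top"
    by (intro tendsto_intros vanish integral_beyond_tendsto_0[OF int])
  moreover have "eventually (\<lambda>b. ?E a - ?E b + F b * tail M b - F a * tail M a
      = (\<integral>u. indicator {a..b} u * (F' u * tail M u) \<partial>lborel)) at_top"
    using eventually_ge_at_top[of a]
  proof eventually_elim
    case (elim b)
    have int_b: "integrable M (\<lambda>x. indicator {b<..} x * F x)"
    proof -
      have "integrable M (\<lambda>x. indicator {b<..} x *\<^sub>R (indicator {a<..} x * F x))"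
        using int by (intro integrable_mult_indicator) (auto simp: M_is_borel)
      moreover have "(\<lambda>x. indicator {b<..} x *\<^sub>R (indicator {a<..} x * F x)) = (\<lambda>x. indicator {b<..} x * F x)"
        using elim by (auto simp: indicator_def)
      ultimately show ?thesis by simp
    qed
    have "(\<integral>x. indicator {a<..} x * F (min x b) \<partial>M)
        = (\<integral>x. indicator {a<..} x * F x - indicator {b<..} x * F x + F b * indicator {b<..} x \<partial>M)"
      using elim by (intro Bochner_Integration.integral_cong) (auto simp: indicator_def min_def)
    also have "\<dots> = ?E a - ?E b + (\<integral>x. F b * indicator {b<..} x \<partial>M)"
      using int int_b integrable_real_indicator[of "{b<..}" M]
      by (simp add: M_is_borel less_top[symmetric])
    also have "(\<integral>x. F b * indicator {b<..} x \<partial>M) = F b * tail M b"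
      by (simp add: tail_def borel_UNIV)
    finally show ?case
      using integral_min_tail[of a b F F'] elim deriv continuous_on_subset[OF cont, of "{a..b}"]
      by auto
  qed
  ultimately show ?thesis by (simp add: tendsto_cong)
qed

end

section \<open>Dominated differences of tails\<close>

text \<open>\<open>M\<close> and \<open>N n\<close> stand for the discounted laws of the limit and
  the approximating models, \<open>F\<close> for the payoff and \<open>r\<close> for a point from
  which it is smooth. Domination is kept in product form, so that nothing is divided by
  \<open>g n\<close>.\<close>

locale dominated_tail_errors =
  fixes M :: "real measure" and N :: "nat \<Rightarrow> real measure"
    and F F' h :: "real \<Rightarrow> real" and g :: "nat \<Rightarrow> real" and r :: real
  assumes M_finite: "finite_borel_measure M" and N_finite: "\<And>n. finite_borel_measure (N n)"
    and deriv: "\<And>u. r \<le> u \<Longrightarrow> (F has_real_derivative F' u) (at u)"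
    and cont: "continuous_on {r..} F'"
    and int_M: "integrable M (\<lambda>x. indicator {r<..} x * F x)"
    and int_N: "\<And>n. integrable (N n) (\<lambda>x. indicator {r<..} x * F x)"
    and vanish_M: "((\<lambda>b. F b * tail M b) \<longlongrightarrow> 0) at_top"
    and vanish_N: "\<And>n. ((\<lambda>b. F b * tail (N n) b) \<longlongrightarrow> 0) at_top"
    and tails: "\<And>a. r \<le> a \<Longrightarrow> isCont (tail M) a \<Longrightarrow> (\<lambda>n. tail (N n) a) \<longlonglongrightarrow> tail M a"
    and h_int: "integrable lborel h" and h_nonneg: "\<And>u. 0 \<le> h u"
    and g_lim: "g \<longlonglongrightarrow> 0"
    and error_bound: "AE u in lborel. r \<le> u \<longrightarrow> (\<forall>n. \<bar>F' u * (tail (N n) u - tail M u)\<bar> \<le> \<bar>g n\<bar> * h u)"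
begin

sublocale M: finite_borel_measure M by (rule M_finite)
sublocale N: finite_borel_measure "N n" for n by (rule N_finite)

definition beyond :: "real measure \<Rightarrow> real \<Rightarrow> real" where
  "beyond K a = (\<integral>x. indicator {a<..} x * F x \<partial>K)"

definition h_beyond :: "real \<Rightarrow> real" where
  "h_beyond a = (\<integral>u. indicator {a..} u * h u \<partial>lborel)"

lemma h_beyond_nonneg: "0 \<le> h_beyond a"
  unfolding h_beyond_def using h_nonneg by simp

lemma h_beyond_tendsto_0: "(h_beyond \<longlongrightarrow> 0) at_top"
proof -
  have [measurable]: "h \<in> borel_measurable borel" using borel_measurable_integrable[OF h_int] by simp
  have "((\<lambda>a. \<integral>u. indicator {a..} u * h u \<partial>lborel) \<longlongrightarrow> (\<integral>u. 0 \<partial>(lborel::real measure))) at_top"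
  proof (rule integral_dominated_convergence_at_top)
    show "integrable lborel h" by (rule h_int)
    show "AE u in lborel. ((\<lambda>a. indicator {a..} u * h u) \<longlongrightarrow> 0) at_top"
    proof (rule AE_I2)
      fix u
      have "eventually (\<lambda>a. indicator {a..} u * h u = 0) at_top"
        using eventually_gt_at_top[of u] by eventually_elim (auto simp: indicator_def)
      then show "((\<lambda>a. indicator {a..} u * h u) \<longlongrightarrow> 0) at_top"
        by (rule tendsto_eventually)
    qed
  qed (auto simp: indicator_def h_nonneg)
  then show ?thesis by (simp add: h_beyond_def[abs_def])
qed

lemma integrable_beyond:
  assumes "r \<le> a" "integrable K (\<lambda>x. indicator {r<..} x * F x)" "sets K = sets borel"
  shows "integrable K (\<lambda>x. indicator {a<..} x * F x)"
proof -
  have "integrable K (\<lambda>x. indicator {a<..} x *\<^sub>R (indicator {r<..} x * F x))"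
    using assms by (intro integrable_mult_indicator) auto
  moreover have "(\<lambda>x. indicator {a<..} x *\<^sub>R (indicator {r<..} x * F x)) = (\<lambda>x. indicator {a<..} x * F x)"
    using assms(1) by (auto simp: indicator_def)
  ultimately show ?thesis by simp
qed

text \<open>Subtracting the integration by parts for \<open>M\<close> from that for
  \<open>N n\<close> leaves a boundary term at \<open>a\<close> and the improper integral of
  \<open>F'\<close> times the difference of tails. By \<open>error_bound\<close> its truncation at
  any \<open>b\<close> is at most \<open>\<bar>g n\<bar> * h_beyond a\<close>, which does not depend
  on \<open>b\<close> and so survives the limit.\<close>

lemma beyond_error_le:
  assumes a: "r \<le> a"
  shows "\<bar>beyond (N n) a - beyond M a\<bar>
       \<le> \<bar>F a\<bar> * \<bar>tail (N n) a - tail M a\<bar> + \<bar>g n\<bar> * h_beyond a"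
proof -
  have cont_a: "continuous_on {a..} F'" using cont a by (auto intro: continuous_on_subset)
  have lim: "((\<lambda>b. \<integral>u. indicator {a..b} u * (F' u * tail K u) \<partial>lborel)
      \<longlongrightarrow> beyond K a - F a * tail K a) at_top"
    if "finite_borel_measure K" "integrable K (\<lambda>x. indicator {r<..} x * F x)"
      "((\<lambda>b. F b * tail K b) \<longlongrightarrow> 0) at_top" for K
    unfolding beyond_def
  proof (rule finite_borel_measure.integral_deriv_tail_tendsto[OF that(1) _ cont_a _ that(3)])
    show "(F has_real_derivative F' u) (at u)" if "a \<le> u" for u using deriv a that by simp
    show "integrable K (\<lambda>x. indicator {a<..} x * F x)"
      using integrable_beyond[OF a that(2)] finite_borel_measure.M_is_borel[OF that(1)] by simp
  qed
  let ?D = "\<lambda>u. tail (N n) u - tail M u"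
  have int_b: "integrable lborel (\<lambda>u. indicator {a..b} u * (F' u * tail K u))"
    if "finite_borel_measure K" for K b
  proof -
    interpret K: finite_borel_measure K by fact
    have F'_int: "integrable lborel (\<lambda>u. indicator {a..b} u *\<^sub>R F' u)"
      using cont_a by (intro borel_integrable_compact) (auto intro: continuous_on_subset)
    note [measurable] = K.borel_measurable_tail
      borel_measurable_integrable[OF F'_int, simplified]
    have "integrable lborel (\<lambda>u. (indicator {a..b} u * F' u) * tail K u)"
    proof (rule Bochner_Integration.integrable_bound)
      show "integrable lborel (\<lambda>u. (indicator {a..b} u * F' u) * measure K UNIV)"
        using F'_int by simp
      show "AE u in lborel. norm ((indicator {a..b} u * F' u) * tail K u)
          \<le> norm ((indicator {a..b} u * F' u) * measure K UNIV)"
        using K.tail_nonneg K.tail_le_total by (auto simp: abs_mult intro!: mult_left_mono)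
    qed measurable
    then show ?thesis by (simp add: mult.assoc)
  qed
  \<comment> \<open>The truncated integrals are subtracted before any estimate, since only the
    difference of the tails is dominated.\<close>
  have "((\<lambda>b. (\<integral>u. indicator {a..b} u * (F' u * tail (N n) u) \<partial>lborel)
       - (\<integral>u. indicator {a..b} u * (F' u * tail M u) \<partial>lborel))
      \<longlongrightarrow> (beyond (N n) a - F a * tail (N n) a) - (beyond M a - F a * tail M a)) at_top"
    by (intro tendsto_diff lim int_M int_N vanish_M vanish_N M_finite N_finite)
  then have "((\<lambda>b. \<integral>u. indicator {a..b} u * (F' u * ?D u) \<partial>lborel)
      \<longlongrightarrow> (beyond (N n) a - F a * tail (N n) a) - (beyond M a - F a * tail M a)) at_top"
    by (simp add: Bochner_Integration.integral_diff[OF int_b[OF N_finite] int_b[OF M_finite], symmetric]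
        right_diff_distrib)
  moreover have "\<bar>\<integral>u. indicator {a..b} u * (F' u * ?D u) \<partial>lborel\<bar> \<le> \<bar>g n\<bar> * h_beyond a" for b
  proof -
    have h_a: "integrable lborel (\<lambda>u. indicator {a..} u * h u)"
      using integrable_mult_indicator[OF _ h_int, of "{a..}"] by simp
    have "integrable lborel (\<lambda>u. indicator {a..b} u * (F' u * tail (N n) u)
        - indicator {a..b} u * (F' u * tail M u))"
      by (intro Bochner_Integration.integrable_diff int_b M_finite N_finite)
    then have int: "integrable lborel (\<lambda>u. indicator {a..b} u * (F' u * ?D u))"
      by (simp add: right_diff_distrib)
    have "\<bar>\<integral>u. indicator {a..b} u * (F' u * ?D u) \<partial>lborel\<bar>
        \<le> (\<integral>u. \<bar>indicator {a..b} u * (F' u * ?D u)\<bar> \<partial>lborel)"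
      by (rule integral_abs_bound)
    also have "\<dots> \<le> (\<integral>u. \<bar>g n\<bar> * (indicator {a..} u * h u) \<partial>lborel)"
    proof (rule integral_mono_AE)
      show "AE u in lborel. \<bar>indicator {a..b} u * (F' u * ?D u)\<bar> \<le> \<bar>g n\<bar> * (indicator {a..} u * h u)"
        using error_bound by eventually_elim (use a h_nonneg in \<open>auto simp: indicator_def\<close>)
    qed (use int h_a in auto)
    finally show ?thesis by (simp add: h_beyond_def)
  qed
  ultimately have "\<bar>(beyond (N n) a - F a * tail (N n) a) - (beyond M a - F a * tail M a)\<bar>
      \<le> \<bar>g n\<bar> * h_beyond a"
    by (intro tendsto_upperbound[OF tendsto_rabs]) auto
  moreover have "\<bar>F a * (tail (N n) a - tail M a)\<bar> = \<bar>F a\<bar> * \<bar>tail (N n) a - tail M a\<bar>"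
    by (rule abs_mult)
  ultimately show ?thesis by (simp add: algebra_simps)
qed

lemma beyond_tendsto:
  assumes "r \<le> a" "isCont (tail M) a"
  shows "(\<lambda>n. beyond (N n) a) \<longlonglongrightarrow> beyond M a"
proof (rule LIM_zero_cancel, rule Lim_null_comparison)
  show "eventually (\<lambda>n. norm (beyond (N n) a - beyond M a)
      \<le> \<bar>F a\<bar> * \<bar>tail (N n) a - tail M a\<bar> + \<bar>g n\<bar> * h_beyond a) sequentially"
    using beyond_error_le[OF assms(1)] by simp
  have "(\<lambda>n. \<bar>F a\<bar> * \<bar>tail (N n) a - tail M a\<bar> + \<bar>g n\<bar> * h_beyond a)
      \<longlonglongrightarrow> \<bar>F a\<bar> * \<bar>tail M a - tail M a\<bar> + \<bar>0\<bar> * h_beyond a"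
    by (intro tendsto_intros tails assms g_lim)
  then show "(\<lambda>n. \<bar>F a\<bar> * \<bar>tail (N n) a - tail M a\<bar> + \<bar>g n\<bar> * h_beyond a) \<longlonglongrightarrow> 0"
    by simp
qed

text \<open>Tightness: convergence at one far continuity point \<open>c\<close> of
  \<open>tail M\<close> handles all large \<open>n\<close>, with monotonicity extending the bound
  beyond \<open>c\<close>. The finitely many other \<open>n\<close> are treated one by one.\<close>

lemma tails_uniformly_small:
  assumes "0 < \<epsilon>"
  obtains a1 where "r \<le> a1" "\<And>a n. a1 \<le> a \<Longrightarrow> tail (N n) a \<le> \<epsilon>"
proof -
  have "eventually (\<lambda>a. tail M a < \<epsilon>) at_top"
    using M.tail_tendsto_0 assms by (rule order_tendstoD)
  then obtain b where b: "\<And>a. b \<le> a \<Longrightarrow> tail M a < \<epsilon>"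
    by (auto simp: eventually_at_top_linorder)
  obtain c where c: "max r b < c" "isCont (tail M) c"
    using M.ex_continuity_point_tail[of "max r b" "max r b + 1"] by auto
  have "eventually (\<lambda>n. tail (N n) c < \<epsilon>) sequentially"
    using tails[of c] c b[of c] by (intro order_tendstoD) auto
  then obtain m where m: "\<And>n. m \<le> n \<Longrightarrow> tail (N n) c < \<epsilon>"
    by (auto simp: eventually_sequentially)
  have "eventually (\<lambda>a. \<forall>n\<in>{..<m}. tail (N n) a < \<epsilon>) at_top"
    using order_tendstoD(2)[OF N.tail_tendsto_0 assms] by (intro eventually_ball_finite) auto
  then obtain d where d: "\<And>a n. d \<le> a \<Longrightarrow> n < m \<Longrightarrow> tail (N n) a < \<epsilon>"
    by (auto simp: eventually_at_top_linorder)
  show thesis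
  proof (rule that[of "max c d"])
    show "r \<le> max c d" using c by auto
    show "tail (N n) a \<le> \<epsilon>" if "max c d \<le> a" for a n
      using d[of a n] m[of n] N.tail_antimono[of c a n] that by (cases "n < m") auto
  qed
qed

text \<open>
  For each fixed \<open>a\<close> the term is small only for large \<open>n\<close>, and for each fixed \<open>n\<close> only for
  large \<open>a\<close>.  If no \<open>a\<close> served all \<open>n\<close>, the tail errors would exceed a multiple of \<open>1 / \<bar>F\<bar>\<close>
  everywhere, so domination would bound the logarithmic derivative \<open>F' / F\<close> by a multiple of \<open>h\<close>.
  Then \<open>F\<close> is bounded, and tightness of the tails gives a contradiction.
\<close>

lemma ex_boundary_term_uniformly_small:
  assumes "0 < \<epsilon>" "r \<le> a1"
  shows "\<exists>a\<ge>a1. \<forall>n. \<bar>F a\<bar> * tail (N n) a \<le> \<epsilon>"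
proof (rule ccontr)
  assume "\<not> ?thesis"
  then have large: "\<exists>n. \<epsilon> < \<bar>F a\<bar> * tail (N n) a" if "a1 \<le> a" for a
    using that by (meson not_le)
  have "eventually (\<lambda>b. \<bar>F b * tail M b\<bar> < \<epsilon> / 2) at_top"
    using vanish_M assms(1) by (intro order_tendstoD) (auto intro!: tendsto_rabs_zero)
  then obtain b where b: "\<And>a. b \<le> a \<Longrightarrow> \<bar>F a\<bar> * tail M a < \<epsilon> / 2"
    using M.tail_nonneg by (auto simp: eventually_at_top_linorder abs_mult)
  define a2 where "a2 = max a1 b"
  have a2: "r \<le> a2" "a1 \<le> a2" "b \<le> a2" using assms by (auto simp: a2_def)
  \<comment> \<open>The term with \<open>tail M\<close> takes less than half of \<epsilon>, so a
    lower bound remains for the difference of tails, the quantity that \<open>error_bound\<close>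
    controls.\<close>
  have gap: "\<exists>n. \<epsilon> / 2 < \<bar>F a\<bar> * \<bar>tail (N n) a - tail M a\<bar>" if le: "a2 \<le> a" for a
  proof -
    obtain n where n: "\<epsilon> < \<bar>F a\<bar> * tail (N n) a" using large[OF order_trans[OF a2(2) le]] by auto
    have "\<bar>F a\<bar> * (tail (N n) a - tail M a) \<le> \<bar>F a\<bar> * \<bar>tail (N n) a - tail M a\<bar>"
      by (intro mult_left_mono) auto
    then show ?thesis using n b[of a] le a2 by (intro exI[of _ n]) (simp add: algebra_simps)
  qed
  have nonzero: "F a \<noteq> 0" if "a2 \<le> a" for a
    using gap[OF that] assms(1) by auto
  have "Bseq g" using g_lim by (auto intro: convergent_imp_Bseq convergentI)
  then obtain G where G: "0 < G" "\<And>n. \<bar>g n\<bar> \<le> G" by (auto simp: Bseq_def)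
  \<comment> \<open>The inner factor combines the bound \<open>G\<close> on \<open>g\<close> with
    the lower bound \<epsilon>/2 from \<open>gap\<close>. The outer 2 belongs to
    \<open>2 * F' u / F u\<close>, the derivative of \<open>ln ((F u)\<^sup>2)\<close>; squaring
    avoids a case split on the sign of \<open>F\<close>.\<close>
  define k where "k u = 2 * (2 * G / \<epsilon> * h u)" for u
  have log_deriv_le: "AE u in lborel. a2 \<le> u \<longrightarrow> 2 * F' u / F u \<le> k u"
    using error_bound
  proof eventually_elim
    case (elim u)
    show ?case
    proof
      assume u: "a2 \<le> u"
      obtain n where n: "\<epsilon> / 2 < \<bar>F u\<bar> * \<bar>tail (N n) u - tail M u\<bar>" using gap[OF u] by auto
      have "\<bar>F' u\<bar> * (\<epsilon> / 2) \<le> \<bar>F' u\<bar> * (\<bar>F u\<bar> * \<bar>tail (N n) u - tail M u\<bar>)"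
        using n by (intro mult_left_mono) auto
      also have "\<dots> = \<bar>F u\<bar> * \<bar>F' u * (tail (N n) u - tail M u)\<bar>" by (simp add: abs_mult)
      also have "\<dots> \<le> \<bar>F u\<bar> * (\<bar>g n\<bar> * h u)" using elim u a2 by (intro mult_left_mono) auto
      also have "\<dots> \<le> \<bar>F u\<bar> * (G * h u)" using G h_nonneg by (intro mult_left_mono mult_right_mono) auto
      finally have "\<bar>F' u\<bar> / \<bar>F u\<bar> \<le> 2 * G / \<epsilon> * h u"
        using nonzero[OF u] assms(1) by (simp add: field_simps)
      moreover have "F' u / F u \<le> \<bar>F' u\<bar> / \<bar>F u\<bar>" by (metis abs_divide abs_ge_self)
      ultimately show "2 * F' u / F u \<le> k u" by (simp add: k_def)
    qed
  qed
  have k_int: "integrable lborel k" unfolding k_def using h_int by simp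
  have k_nonneg: "0 \<le> k u" for u using G assms(1) h_nonneg by (simp add: k_def)
  define K where "K = (\<integral>u. k u \<partial>lborel)"
  have log_le: "ln ((F b)\<^sup>2) - ln ((F a2)\<^sup>2) \<le> K" if b: "a2 \<le> b" for b
  proof -
    have F_cont: "continuous_on {a2..b} F"
      using deriv a2 by (intro DERIV_continuous_on[where D=F']) (auto intro: has_field_derivative_at_within)
    have cont': "continuous_on {a2..b} (\<lambda>u. 2 * F' u / F u)"
      using nonzero a2 by (intro continuous_intros F_cont continuous_on_subset[OF cont]) auto
    have "(\<integral>u. indicator {a2..b} u *\<^sub>R (2 * F' u / F u) \<partial>lborel) = ln ((F b)\<^sup>2) - ln ((F a2)\<^sup>2)"
    proof (rule integral_FTC_atLeastAtMost[OF b _ cont'])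
      fix u assume u: "a2 \<le> u" "u \<le> b"
      have "((\<lambda>u. ln ((F u)\<^sup>2)) has_real_derivative 2 * F' u / F u) (at u)"
        using deriv[of u] u a2 nonzero[of u]
        by (auto intro!: derivative_eq_intros simp: power2_eq_square zero_less_mult_iff)
      then show "((\<lambda>u. ln ((F u)\<^sup>2)) has_vector_derivative 2 * F' u / F u) (at u within {a2..b})"
        by (simp add: has_real_derivative_iff_has_vector_derivative has_vector_derivative_at_within)
    qed
    moreover have "(\<integral>u. indicator {a2..b} u *\<^sub>R (2 * F' u / F u) \<partial>lborel) \<le> K"
      unfolding K_def
    proof (rule integral_mono_AE[OF _ k_int])
      show "integrable lborel (\<lambda>u. indicator {a2..b} u *\<^sub>R (2 * F' u / F u))"
        using cont' by (intro borel_integrable_compact) auto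
      show "AE u in lborel. indicator {a2..b} u *\<^sub>R (2 * F' u / F u) \<le> k u"
        using log_deriv_le by eventually_elim (use k_nonneg in \<open>auto simp: indicator_def\<close>)
    qed
    ultimately show ?thesis by simp
  qed
  \<comment> \<open>\<open>log_le\<close> bounds the square of \<open>F b\<close> by
    \<open>(F a2)\<^sup>2 * exp K\<close>; adding 1 bounds \<open>\<bar>F b\<bar>\<close> itself,
    since \<open>\<bar>x\<bar> \<le> x\<^sup>2 + 1\<close>.\<close>
  define B where "B = (F a2)\<^sup>2 * exp K + 1"
  have F_le: "\<bar>F b\<bar> \<le> B" if "a2 \<le> b" for b
  proof -
    have pos: "0 < (F b)\<^sup>2" "0 < (F a2)\<^sup>2" using nonzero[OF that] nonzero[of a2] by auto
    have "exp (ln ((F b)\<^sup>2)) \<le> exp (ln ((F a2)\<^sup>2) + K)"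
      using log_le[OF that] by simp
    then have "(F b)\<^sup>2 \<le> (F a2)\<^sup>2 * exp K"
      by (simp only: exp_add exp_ln[OF pos(1)] exp_ln[OF pos(2)])
    moreover have "\<bar>F b\<bar> \<le> (F b)\<^sup>2 + 1"
      using zero_le_power2[of "\<bar>F b\<bar> - 1"] by (simp add: power2_diff)
    ultimately show ?thesis by (simp add: B_def)
  qed
  have "0 < B" by (simp add: B_def add_nonneg_pos)
  \<comment> \<open>Tightness at level \<open>\<epsilon> / B\<close> makes
    \<open>\<bar>F a\<bar> * tail (N n) a\<close> at most \<epsilon> for all \<open>n\<close> at
    once, against \<open>large\<close>.\<close>
  then have "0 < \<epsilon> / B" using assms(1) by simp
  then obtain a3 where "r \<le> a3" and a3: "\<And>a n. a3 \<le> a \<Longrightarrow> tail (N n) a \<le> \<epsilon> / B"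
    using tails_uniformly_small by blast
  define a where "a = max a2 a3"
  have "a1 \<le> a" "a2 \<le> a" "a3 \<le> a" using a2(2) unfolding a_def by linarith+
  obtain n where "\<epsilon> < \<bar>F a\<bar> * tail (N n) a" using large[OF \<open>a1 \<le> a\<close>] by auto
  also have "\<dots> \<le> B * (\<epsilon> / B)"
    using F_le[OF \<open>a2 \<le> a\<close>] a3[OF \<open>a3 \<le> a\<close>] N.tail_nonneg \<open>0 < B\<close> by (intro mult_mono) auto
  finally show False using \<open>0 < B\<close> by simp
qed

text \<open>Splitting the difference of tails in \<open>beyond_error_le\<close> leaves four terms,
  each given a quarter of \<epsilon>. Three are small for all large \<open>a\<close>, uniformly in
  \<open>n\<close>. The boundary term of \<open>N n\<close> is controlled only at some
  \<open>a\<close> beyond any given point, which is enough once the other three are settled.\<close>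

lemma ex_beyond_uniformly_small:
  assumes "0 < \<epsilon>"
  shows "\<exists>a\<ge>r. \<forall>n. \<bar>beyond (N n) a\<bar> \<le> \<epsilon>"
proof -
  have "Bseq g" using g_lim by (auto intro: convergent_imp_Bseq convergentI)
  then obtain G where G: "0 < G" "\<And>n. \<bar>g n\<bar> \<le> G" by (auto simp: Bseq_def)
  have "eventually (\<lambda>a. \<bar>beyond M a\<bar> < \<epsilon> / 4) at_top"
    using M.integral_beyond_tendsto_0[OF int_M] assms unfolding beyond_def
    by (intro order_tendstoD) (auto intro!: tendsto_rabs_zero)
  moreover have "eventually (\<lambda>a. \<bar>F a * tail M a\<bar> < \<epsilon> / 4) at_top"
    using vanish_M assms by (intro order_tendstoD) (auto intro!: tendsto_rabs_zero)
  moreover have "eventually (\<lambda>a. G * h_beyond a < \<epsilon> / 4) at_top"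
    using tendsto_mult_left[OF h_beyond_tendsto_0, of G] assms by (intro order_tendstoD) auto
  moreover note eventually_ge_at_top[of r]
  ultimately have "eventually (\<lambda>a. \<bar>beyond M a\<bar> < \<epsilon> / 4 \<and> \<bar>F a * tail M a\<bar> < \<epsilon> / 4
      \<and> G * h_beyond a < \<epsilon> / 4 \<and> r \<le> a) at_top"
    by eventually_elim simp
  then obtain a1 where a1: "\<And>a. a1 \<le> a \<Longrightarrow> \<bar>beyond M a\<bar> < \<epsilon> / 4 \<and> \<bar>F a * tail M a\<bar> < \<epsilon> / 4
      \<and> G * h_beyond a < \<epsilon> / 4 \<and> r \<le> a"
    by (auto simp: eventually_at_top_linorder)
  obtain a where a: "a1 \<le> a" "\<And>n. \<bar>F a\<bar> * tail (N n) a \<le> \<epsilon> / 4"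
    using ex_boundary_term_uniformly_small[of "\<epsilon> / 4" a1] a1[of a1] assms by auto
  have ra: "r \<le> a" using a1[OF a(1)] by simp
  have "\<bar>beyond (N n) a\<bar> \<le> \<epsilon>" for n
  proof -
    have "\<bar>F a\<bar> * \<bar>tail (N n) a - tail M a\<bar> \<le> \<bar>F a\<bar> * (tail (N n) a + tail M a)"
      using M.tail_nonneg[of a] N.tail_nonneg[of n a] by (intro mult_left_mono) auto
    moreover have "\<bar>F a * tail M a\<bar> = \<bar>F a\<bar> * tail M a" using M.tail_nonneg[of a] by (simp add: abs_mult)
    moreover have "\<bar>g n\<bar> * h_beyond a \<le> G * h_beyond a"
      using G h_beyond_nonneg by (intro mult_right_mono)
    ultimately show ?thesis
      using beyond_error_le[OF ra, of n] a(2)[of n] a1[OF a(1)] unfolding distrib_left by linarith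
  qed
  then show ?thesis using ra by blast
qed

end

section \<open>Payoffs\<close>

lemma continuous_on_finite_exceptions_borel_measurable:
  fixes f :: "real \<Rightarrow> real"
  assumes "continuous_on (S - P) f" "finite P" "S \<in> sets borel"
  shows "(\<lambda>x. indicator S x * f x) \<in> borel_measurable borel"
proof (rule measurable_discrete_difference)
  have "P \<in> sets borel" using assms(2) by (simp add: finite_imp_closed borel_closed)
  then show "(\<lambda>x. indicator (S - P) x *\<^sub>R f x) \<in> borel_measurable borel"
    using assms by (intro borel_measurable_continuous_on_indicator) auto
  show "countable P" using assms(2) by (rule countable_finite)
qed (auto simp: indicator_def)

lemma payoff_class_exceptions:
  assumes "f \<in> payoff_class"
  obtains P where "finite P" "continuous_on ({0..} - P) (payoff_deriv f)"
    "\<And>a. 0 \<le> a \<Longrightarrow> a \<notin> P \<Longrightarrow> f differentiable (at a within {0..})"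
    "\<And>s. s \<in> P \<Longrightarrow> \<exists>l. (f \<longlongrightarrow> l) (at_right s)"
    "\<And>s. s \<in> P \<Longrightarrow> s \<noteq> 0 \<Longrightarrow> \<exists>l. (f \<longlongrightarrow> l) (at_left s)"
proof -
  from assms obtain P where P: "finite P \<and> P \<subseteq> {0..} \<and>
     (\<forall>a\<in>{0..} - P. f differentiable (at a within {0..})) \<and>
     continuous_on ({0..} - P) (payoff_deriv f) \<and>
     (\<forall>s\<in>P. (\<exists>l. (f \<longlongrightarrow> l) (at_right s)) \<and> (\<exists>l. (payoff_deriv f \<longlongrightarrow> l) (at_right s))) \<and>
     (\<forall>s\<in>P - {0}. (\<exists>l. (f \<longlongrightarrow> l) (at_left s)) \<and> (\<exists>l. (payoff_deriv f \<longlongrightarrow> l) (at_left s)))"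
    unfolding payoff_class_def by (elim CollectE exE)
  show thesis by (rule that[of P]) (use P in simp_all)
qed

lemma payoff_class_finite_discontinuities:
  assumes "f \<in> payoff_class"
  shows "finite {a. 0 \<le> a \<and> \<not> continuous (at a within {0..}) f}"
proof -
  obtain P where P: "finite P" "continuous_on ({0..} - P) (payoff_deriv f)"
    "\<And>a. 0 \<le> a \<Longrightarrow> a \<notin> P \<Longrightarrow> f differentiable (at a within {0..})"
    "\<And>s. s \<in> P \<Longrightarrow> \<exists>l. (f \<longlongrightarrow> l) (at_right s)"
    "\<And>s. s \<in> P \<Longrightarrow> s \<noteq> 0 \<Longrightarrow> \<exists>l. (f \<longlongrightarrow> l) (at_left s)"
    by (rule payoff_class_exceptions[OF assms]) blast
  have "{a. 0 \<le> a \<and> \<not> continuous (at a within {0..}) f} \<subseteq> P"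
    using P(3) differentiable_imp_continuous_within by blast
  then show ?thesis using P(1) finite_subset by blast
qed

text \<open>The indicators are there because a payoff is arbitrary at negative arguments.\<close>

lemma borel_measurable_payoff:
  assumes "f \<in> payoff_class"
  shows "(\<lambda>x. indicator {0..} x * f x) \<in> borel_measurable borel"
    and "(\<lambda>x. indicator {0..} x * payoff_deriv f x) \<in> borel_measurable borel"
proof -
  obtain P where P: "finite P" "continuous_on ({0..} - P) (payoff_deriv f)"
    "\<And>a. 0 \<le> a \<Longrightarrow> a \<notin> P \<Longrightarrow> f differentiable (at a within {0..})"
    "\<And>s. s \<in> P \<Longrightarrow> \<exists>l. (f \<longlongrightarrow> l) (at_right s)"
    "\<And>s. s \<in> P \<Longrightarrow> s \<noteq> 0 \<Longrightarrow> \<exists>l. (f \<longlongrightarrow> l) (at_left s)"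
    by (rule payoff_class_exceptions[OF assms]) blast
  have "continuous_on ({0..} - P) f"
    unfolding continuous_on_eq_continuous_within
  proof
    fix x assume "x \<in> {0..} - P"
    then have "continuous (at x within {0..}) f"
      using P(3) differentiable_imp_continuous_within by auto
    then show "continuous (at x within {0..} - P) f" by (rule continuous_within_subset) auto
  qed
  then show "(\<lambda>x. indicator {0..} x * f x) \<in> borel_measurable borel"
    using P(1) by (rule continuous_on_finite_exceptions_borel_measurable) auto
  show "(\<lambda>x. indicator {0..} x * payoff_deriv f x) \<in> borel_measurable borel"
    using P(2,1) by (rule continuous_on_finite_exceptions_borel_measurable) auto
qed

lemma payoff_eventually_smooth:
  assumes "f \<in> payoff_class"
  obtains r where "0 < r" "continuous_on {r..} (payoff_deriv f)"
    "\<And>u. r \<le> u \<Longrightarrow> (f has_real_derivative payoff_deriv f u) (at u)"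
proof -
  obtain P where P: "finite P" "continuous_on ({0..} - P) (payoff_deriv f)"
    "\<And>a. 0 \<le> a \<Longrightarrow> a \<notin> P \<Longrightarrow> f differentiable (at a within {0..})"
    "\<And>s. s \<in> P \<Longrightarrow> \<exists>l. (f \<longlongrightarrow> l) (at_right s)"
    "\<And>s. s \<in> P \<Longrightarrow> s \<noteq> 0 \<Longrightarrow> \<exists>l. (f \<longlongrightarrow> l) (at_left s)"
    by (rule payoff_class_exceptions[OF assms]) blast
  \<comment> \<open>Inserting 0 gives the set a maximum even for empty \<open>P\<close> and makes
    \<open>r\<close> positive, so that derivatives within \<open>{0..}\<close> are ordinary ones
    from \<open>r\<close> on.\<close>
  define r where "r = Max (insert 0 P) + 1"
  have r: "p < r" if "p \<in> insert 0 P" for p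
    using Max_ge[OF finite.insertI[OF P(1)] that] unfolding r_def by linarith
  show thesis
  proof
    show "0 < r" using r by simp
    show "continuous_on {r..} (payoff_deriv f)"
      by (rule continuous_on_subset[OF P(2)]) (use r in \<open>force simp: not_less[symmetric]\<close>)
    fix u assume u: "r \<le> u"
    have at_u: "at u within {0..} = at u"
      using u r[of 0] by (intro at_within_interior) auto
    have "f differentiable (at u)"
      using P(3)[of u] r[of u] r[of 0] u at_u by force
    then show "(f has_real_derivative payoff_deriv f u) (at u)"
      unfolding payoff_deriv_def at_u has_real_derivative_iff_has_vector_derivative
      by (simp add: vector_derivative_works)
  qed
qed

section \<open>Boundedness of payoffs on bounded intervals\<close>

lemma tendsto_imp_eventually_abs_le:
  fixes f :: "'a \<Rightarrow> real"
  assumes "(f \<longlongrightarrow> l) F"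
  shows "eventually (\<lambda>x. \<bar>f x\<bar> \<le> \<bar>l\<bar> + 1) F"
  using order_tendstoD(2)[OF tendsto_rabs[OF assms], of "\<bar>l\<bar> + 1"]
  by (auto elim: eventually_mono)

text \<open>Outside the exceptional set this is continuity; at an exceptional point the one-sided
  limits bound each side. The filter omits \<open>x\<close> itself, whose value may be unrelated to
  these limits.\<close>

lemma payoff_locally_bounded:
  assumes "f \<in> payoff_class" "0 \<le> x"
  shows "\<exists>C. eventually (\<lambda>y. \<bar>f y\<bar> \<le> C) (at x within {0..})"
proof -
  obtain P where P: "finite P" "continuous_on ({0..} - P) (payoff_deriv f)"
    "\<And>a. 0 \<le> a \<Longrightarrow> a \<notin> P \<Longrightarrow> f differentiable (at a within {0..})"
    "\<And>s. s \<in> P \<Longrightarrow> \<exists>l. (f \<longlongrightarrow> l) (at_right s)"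
    "\<And>s. s \<in> P \<Longrightarrow> s \<noteq> 0 \<Longrightarrow> \<exists>l. (f \<longlongrightarrow> l) (at_left s)"
    by (rule payoff_class_exceptions[OF assms(1)]) blast
  show ?thesis
  proof (cases "x \<in> P")
    case False
    then have "continuous (at x within {0..}) f"
      using P(3) assms(2) differentiable_imp_continuous_within by auto
    then show ?thesis
      unfolding continuous_within by (blast dest: tendsto_imp_eventually_abs_le)
  next
    case True
    then obtain l where l: "(f \<longlongrightarrow> l) (at_right x)" using P(4) by auto
    show ?thesis
    proof (cases "x = 0")
      case True
      have "at x within {0..} = at_right x"
        using True by (simp add: at_within_def) (rule arg_cong[where f="\<lambda>S. inf (nhds 0) (principal S)"], auto)
      then show ?thesis using tendsto_imp_eventually_abs_le[OF l] by auto
    next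
      case False
      then obtain k where "(f \<longlongrightarrow> k) (at_left x)" using P(5) \<open>x \<in> P\<close> by auto
      from tendsto_imp_eventually_abs_le[OF this] tendsto_imp_eventually_abs_le[OF l]
      have "eventually (\<lambda>y. \<bar>f y\<bar> \<le> \<bar>k\<bar> + \<bar>l\<bar> + 1) (at x)"
        unfolding eventually_at_split by (auto elim!: eventually_mono)
      then have "eventually (\<lambda>y. \<bar>f y\<bar> \<le> \<bar>k\<bar> + \<bar>l\<bar> + 1) (at x within {0..})"
        by (rule filter_leD[OF at_le[OF subset_UNIV]])
      then show ?thesis by blast
    qed
  qed
qed

lemma payoff_bounded_on_compact:
  assumes "f \<in> payoff_class"
  obtains C where "\<And>x. 0 \<le> x \<Longrightarrow> x \<le> a \<Longrightarrow> \<bar>f x\<bar> \<le> C"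
proof -
  have "\<exists>U C. open U \<and> x \<in> U \<and> (\<forall>y\<in>U \<inter> {0..}. \<bar>f y\<bar> \<le> C)" if "x \<in> {0..a}" for x
  proof -
    obtain C where "eventually (\<lambda>y. \<bar>f y\<bar> \<le> C) (at x within {0..})"
      using payoff_locally_bounded[OF assms, of x] \<open>x \<in> {0..a}\<close> by auto
    then obtain U where "open U" "x \<in> U" "\<forall>y\<in>U. y \<noteq> x \<longrightarrow> y \<in> {0..} \<longrightarrow> \<bar>f y\<bar> \<le> C"
      unfolding eventually_at_topological by auto
    \<comment> \<open>The maximum readmits the centre \<open>x\<close>, which the punctured filter
      left out.\<close>
    then show ?thesis by (intro exI[of _ U] exI[of _ "max C \<bar>f x\<bar>"]) (auto simp: le_max_iff_disj)
  qed
  then obtain U c where U: "\<And>x. x \<in> {0..a} \<Longrightarrow> open (U x)" "\<And>x. x \<in> {0..a} \<Longrightarrow> x \<in> U x"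
    "\<And>x y. x \<in> {0..a} \<Longrightarrow> y \<in> U x \<Longrightarrow> 0 \<le> y \<Longrightarrow> \<bar>f y\<bar> \<le> c x"
    by (metis IntI atLeast_iff)
  obtain D where D: "D \<subseteq> {0..a}" "finite D" "{0..a} \<subseteq> (\<Union>x\<in>D. U x)"
    by (rule compactE_image[OF compact_Icc, where C="{0..a}" and f=U]) (use U in blast)+
  show thesis
  proof
    fix y assume y: "0 \<le> y" "y \<le> a"
    then obtain x where x: "x \<in> D" "y \<in> U x" using D(3) by auto
    then have "\<bar>f y\<bar> \<le> \<bar>c x\<bar>" using U(3)[of x y] D(1) y by force
    \<comment> \<open>The sum over the finite subcover serves as a common bound; unlike a maximum it
      also makes sense for empty \<open>D\<close>.\<close>
    also have "\<dots> \<le> (\<Sum>x\<in>D. \<bar>c x\<bar>)" using x D(2) by (intro member_le_sum) auto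
    finally show "\<bar>f y\<bar> \<le> (\<Sum>x\<in>D. \<bar>c x\<bar>)" .
  qed
qed

section \<open>The discounted law of the underlying\<close>

definition discounted_law :: "real \<Rightarrow> 'a model \<Rightarrow> real measure" where
  "discounted_law T M =
     distr (density (pricing_measure M) (\<lambda>\<omega>. ennreal (inverse (bond M T \<omega>)))) borel (underlying M T)"

text \<open>The generators of the filtration are stock events, measurable in the market, so its
  sigma-algebra at \<open>T\<close> is a subalgebra of that of the pricing measure and adaptedness
  yields measurability. The bond starts at 1 and increases, hence is at least 1 at
  \<open>T\<close>.\<close>

lemma model_pricing_measure:
  assumes "0 < T" "is_model T M"
  shows "prob_space (pricing_measure M)"
    and "bond M T \<in> borel_measurable (pricing_measure M)"
    and "underlying M T \<in> borel_measurable (pricing_measure M)"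
    and "\<And>\<omega>. \<omega> \<in> space (pricing_measure M) \<Longrightarrow> 1 \<le> bond M T \<omega>"
    and "\<And>\<omega>. \<omega> \<in> space (pricing_measure M) \<Longrightarrow> 0 \<le> underlying M T \<omega>"
proof -
  let ?P = "phys_measure M" and ?Q = "pricing_measure M"
  have sets_eq: "sets ?Q = sets ?P" and "prob_space ?Q"
    using assms(2) by (auto simp: is_model_def equivalent_martingale_measure_def)
  then show "prob_space ?Q" by simp
  have space_eq: "space ?Q = space ?P" by (rule sets_eq_imp_space_eq[OF sets_eq])
  define gens where "gens = (\<Union>s\<in>{0..T}. {stock M s -` A \<inter> space ?P | A. A \<in> sets borel})"
  have gens: "gens \<subseteq> sets ?P"
    using assms(2) by (auto simp: gens_def is_model_def intro: measurable_sets)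
  have "gens \<subseteq> Pow (space ?P)" by (auto simp: gens_def)
  then have sub: "subalgebra ?Q (model_filtration M T)"
    unfolding subalgebra_def natural_filtration_def gens_def[symmetric] sets_eq space_eq
    by (simp add: sets.sigma_sets_subset[OF gens])
  have "bond M T \<in> borel_measurable (model_filtration M T)"
    "underlying M T \<in> borel_measurable (model_filtration M T)"
    using assms by (auto simp: is_model_def adapted_upto_def)
  then show "bond M T \<in> borel_measurable ?Q" "underlying M T \<in> borel_measurable ?Q"
    using measurable_from_subalg[OF sub] by auto
  show "1 \<le> bond M T \<omega>" if "\<omega> \<in> space ?Q" for \<omega>
  proof -
    have "bond M 0 \<omega> = 1" "mono_on {0..T} (\<lambda>t. bond M t \<omega>)"
      using assms(2) that space_eq by (auto simp: is_model_def)
    then show ?thesis using assms(1) by (auto dest: mono_onD[of _ _ 0 T])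
  qed
  show "0 \<le> underlying M T \<omega>" if "\<omega> \<in> space ?Q" for \<omega>
    using assms(2) that space_eq by (auto simp: is_model_def)
qed

lemma finite_borel_measure_discounted_law:
  assumes "0 < T" "is_model T M"
  shows "finite_borel_measure (discounted_law T M)"
proof -
  note props = model_pricing_measure[OF assms]
  interpret Q: prob_space "pricing_measure M" by (rule props)
  note [measurable] = props(2,3)
  have "emeasure (discounted_law T M) UNIV = (\<integral>\<^sup>+\<omega>. ennreal (inverse (bond M T \<omega>)) \<partial>pricing_measure M)"
    by (simp add: discounted_law_def emeasure_distr emeasure_density cong: nn_integral_cong_simp)
  also have "\<dots> \<le> (\<integral>\<^sup>+\<omega>. 1 \<partial>pricing_measure M)"
    using props(4) by (intro nn_integral_mono) (auto simp: ennreal_le_1 inverse_le_1_iff)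
  also have "\<dots> < \<top>" by (simp add: Q.emeasure_space_1)
  finally have "finite_measure (discounted_law T M)"
    by (intro finite_measureI) (simp add: discounted_law_def)
  then show ?thesis
    by (simp add: finite_borel_measure_def finite_borel_measure_axioms_def discounted_law_def)
qed

text \<open>Two functions appear because a payoff \<psi> is controlled only on \<open>{0..}\<close>,
  while integration against a Borel measure calls for a Borel \<phi> on the whole line. The
  underlying is nonnegative at \<open>T\<close>, so agreement on \<open>{0..}\<close> is
  enough.\<close>

lemma expect_discounted_eq_integral:
  assumes "0 < T" "is_model T M" "\<phi> \<in> borel_measurable borel" "\<And>x. 0 \<le> x \<Longrightarrow> \<psi> x = \<phi> x"
  shows "expect_discounted T M \<psi> = (\<integral>x. \<phi> x \<partial>discounted_law T M)"
proof -
  note props = model_pricing_measure[OF assms(1,2)]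
  note [measurable] = props(2,3) assms(3)
  have "(\<integral>x. \<phi> x \<partial>discounted_law T M)
      = (\<integral>\<omega>. inverse (bond M T \<omega>) *\<^sub>R \<phi> (underlying M T \<omega>) \<partial>pricing_measure M)"
    unfolding discounted_law_def
    by (subst integral_distr, measurable, subst integral_density)
       (auto intro!: AE_I2 order_trans[OF zero_le_one props(4)])
  also have "\<dots> = expect_discounted T M \<psi>"
    unfolding expect_discounted_def using props(5) assms(4)
    by (intro Bochner_Integration.integral_cong) auto
  finally show ?thesis ..
qed

text \<open>The bond is at least 1 at \<open>T\<close>, so discounting only shrinks the
  integrand.\<close>

lemma integrable_discounted_law:
  fixes \<phi> \<psi> :: "real \<Rightarrow> real"
  assumes "0 < T" "is_model T M" "\<phi> \<in> borel_measurable borel" "\<And>x. 0 \<le> x \<Longrightarrow> \<bar>\<phi> x\<bar> \<le> \<bar>\<psi> x\<bar>"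
    and "integrable (pricing_measure M) (\<lambda>\<omega>. \<psi> (underlying M T \<omega>))"
  shows "integrable (discounted_law T M) \<phi>"
proof -
  note props = model_pricing_measure[OF assms(1,2)]
  note [measurable] = props(2,3) assms(3)
  have "integrable (pricing_measure M) (\<lambda>\<omega>. inverse (bond M T \<omega>) *\<^sub>R \<phi> (underlying M T \<omega>))"
  proof (rule Bochner_Integration.integrable_bound[OF assms(5)])
    show "AE \<omega> in pricing_measure M. norm (inverse (bond M T \<omega>) *\<^sub>R \<phi> (underlying M T \<omega>))
        \<le> norm (\<psi> (underlying M T \<omega>))"
    proof (rule AE_I2)
      fix \<omega> assume \<omega>: "\<omega> \<in> space (pricing_measure M)"
      have "\<bar>inverse (bond M T \<omega>)\<bar> * \<bar>\<phi> (underlying M T \<omega>)\<bar> \<le> 1 * \<bar>\<psi> (underlying M T \<omega>)\<bar>"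
        using props(4,5)[OF \<omega>] assms(4) by (intro mult_mono) (auto simp: inverse_le_1_iff)
      then show "norm (inverse (bond M T \<omega>) *\<^sub>R \<phi> (underlying M T \<omega>)) \<le> norm (\<psi> (underlying M T \<omega>))"
        by (simp add: abs_mult)
    qed
  qed measurable
  then show ?thesis
    unfolding discounted_law_def
    by (subst integrable_distr_eq, measurable, subst integrable_density)
       (auto intro!: AE_I2 order_trans[OF zero_le_one props(4)])
qed

section \<open>Digital and bond prices in terms of the discounted law\<close>

lemma digital_price_eq_tail:
  assumes "0 < T" "is_model T M"
  shows "digital_price T M = tail (discounted_law T M)"
proof
  interpret finite_borel_measure "discounted_law T M"
    by (rule finite_borel_measure_discounted_law[OF assms])
  fix a
  have "digital_price T M a = (\<integral>x. indicator {a<..} x \<partial>discounted_law T M)"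
    unfolding digital_price_def by (rule expect_discounted_eq_integral[OF assms]) auto
  then show "digital_price T M a = tail (discounted_law T M) a"
    by (simp add: tail_def borel_UNIV)
qed

lemma bond_price_eq_total:
  assumes "0 < T" "is_model T M"
  shows "bond_price T M = measure (discounted_law T M) UNIV"
proof -
  interpret finite_borel_measure "discounted_law T M"
    by (rule finite_borel_measure_discounted_law[OF assms])
  have "bond_price T M = (\<integral>x. 1 \<partial>discounted_law T M)"
    unfolding bond_price_def by (rule expect_discounted_eq_integral[OF assms]) auto
  then show ?thesis by (simp add: borel_UNIV)
qed

text \<open>The discount factor is strictly positive, and such a function has a nonzero integral
  over a probability space. This provides the positive masses for
  \<open>tendsto_integral_of_tails\<close>.\<close>

lemma bond_price_pos:
  assumes "0 < T" "is_model T M"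
  shows "0 < bond_price T M"
proof -
  note props = model_pricing_measure[OF assms]
  interpret Q: prob_space "pricing_measure M" by (rule props)
  note [measurable] = props(2)
  have pos: "0 < inverse (bond M T \<omega>)" if "\<omega> \<in> space (pricing_measure M)" for \<omega>
    using props(4)[OF that] by simp
  have int: "integrable (pricing_measure M) (\<lambda>\<omega>. inverse (bond M T \<omega>))"
  proof (rule Q.integrable_const_bound[where B=1])
    show "AE \<omega> in pricing_measure M. norm (inverse (bond M T \<omega>)) \<le> 1"
      using props(4) by (auto intro!: AE_I2 simp: inverse_le_1_iff dest!: props(4))
  qed measurable
  have "\<not> (AE \<omega> in pricing_measure M. inverse (bond M T \<omega>) = 0)"
  proof
    assume "AE \<omega> in pricing_measure M. inverse (bond M T \<omega>) = 0"
    then have "AE \<omega> in pricing_measure M. False"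
      using AE_space by eventually_elim (use pos in force)
    then show False by simp
  qed
  moreover have "AE \<omega> in pricing_measure M. 0 \<le> inverse (bond M T \<omega>)"
    using pos by (auto intro: AE_I2 less_imp_le)
  ultimately have "0 < (\<integral>\<omega>. inverse (bond M T \<omega>) \<partial>pricing_measure M)"
    using integral_nonneg_AE integral_nonneg_eq_0_iff_AE[OF int] by (metis less_le)
  then show ?thesis by (simp add: bond_price_def expect_discounted_def)
qed

text \<open>A nonnegative underlying always exceeds a negative strike. Thus convergence of bond
  prices supplies the negative strikes, on which \<open>models_converge\<close> says nothing
  directly.\<close>

lemma digital_price_neg_strike:
  assumes "0 < T" "is_model T M" "a < 0"
  shows "digital_price T M a = bond_price T M"
  unfolding digital_price_def bond_price_def expect_discounted_def
  using model_pricing_measure(5)[OF assms(1,2)] assms(3)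
  by (intro Bochner_Integration.integral_cong) (auto simp: indicator_def dest: model_pricing_measure(5)[OF assms(1,2)])

lemma isCont_digital_price_neg_strike:
  assumes "0 < T" "is_model T M" "a < 0"
  shows "isCont (digital_price T M) a"
proof -
  have "eventually (\<lambda>x. x < 0) (nhds a)" using assms(3) by (intro eventually_nhds_in_open[of "{..<0}", simplified]) auto
  then have "eventually (\<lambda>x. digital_price T M x = bond_price T M) (nhds a)"
    by eventually_elim (rule digital_price_neg_strike[OF assms(1,2)])
  then show ?thesis by (simp add: isCont_cong)
qed

text \<open>Links the decay condition in \<open>payoff_class_wrt\<close>, stated with undiscounted
  probabilities, to the tails of the discounted law.\<close>

lemma digital_price_le_prob:
  assumes "0 < T" "is_model T M"
  shows "digital_price T M a
       \<le> measure (pricing_measure M) {\<omega> \<in> space (pricing_measure M). a \<le> underlying M T \<omega>}"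
proof -
  note props = model_pricing_measure[OF assms]
  interpret Q: prob_space "pricing_measure M" by (rule props)
  note [measurable] = props(2,3)
  let ?A = "{\<omega> \<in> space (pricing_measure M). a \<le> underlying M T \<omega>}"
  have le: "inverse (bond M T \<omega>) * indicator {a<..} (underlying M T \<omega>) \<le> indicator ?A \<omega>"
    if "\<omega> \<in> space (pricing_measure M)" for \<omega>
    using props(4)[OF that] that by (auto simp: indicator_def inverse_le_1_iff)
  have nn: "0 \<le> inverse (bond M T \<omega>) * indicator {a<..} (underlying M T \<omega>)"
    if "\<omega> \<in> space (pricing_measure M)" for \<omega>
    using props(4)[OF that] by simp
  have int_A: "integrable (pricing_measure M) (indicator ?A :: _ \<Rightarrow> real)"
    by (rule integrable_real_indicator) (auto simp: less_top[symmetric])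
  have "integrable (pricing_measure M) (\<lambda>\<omega>. inverse (bond M T \<omega>) * indicator {a<..} (underlying M T \<omega>))"
    by (rule Bochner_Integration.integrable_bound[OF int_A]) (use le nn in \<open>auto intro!: AE_I2\<close>)
  then have "digital_price T M a \<le> (\<integral>\<omega>. indicator ?A \<omega> \<partial>pricing_measure M)"
    unfolding digital_price_def expect_discounted_def using int_A le by (rule integral_mono)
  then show ?thesis by simp
qed

section \<open>Dominated digital price errors\<close>

lemma bigo_tendsto_0:
  fixes u g :: "nat \<Rightarrow> real"
  assumes "u \<in> O(g)" "g \<longlonglongrightarrow> 0"
  shows "u \<longlonglongrightarrow> 0"
proof -
  obtain c where "eventually (\<lambda>n. norm (u n) \<le> c * norm (g n)) sequentially"
    using assms(1) by (auto elim: landau_o.bigE)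
  moreover have "(\<lambda>n. c * norm (g n)) \<longlonglongrightarrow> 0"
    using assms(2) by (intro tendsto_mult_right_zero tendsto_norm_zero)
  ultimately show ?thesis by (rule Lim_null_comparison)
qed

lemma digital_and_bond_prices_tendsto:
  assumes "0 < T" "is_model T M" "\<And>n. is_model T (Mn n)" "models_converge T Mn M"
  shows "(\<lambda>n. bond_price T (Mn n)) \<longlonglongrightarrow> bond_price T M"
    and "isCont (digital_price T M) a \<Longrightarrow> (\<lambda>n. digital_price T (Mn n) a) \<longlonglongrightarrow> digital_price T M a"
proof -
  obtain g where g: "g \<longlonglongrightarrow> (0::real)"
      "\<And>a. 0 \<le> a \<Longrightarrow> isCont (digital_price T M) a \<Longrightarrow>
        (\<lambda>n. digital_price T (Mn n) a - digital_price T M a) \<in> O(g)"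
      "(\<lambda>n. bond_price T (Mn n) - bond_price T M) \<in> O(g)"
    using assms(4) unfolding models_converge_def by blast
  show bonds: "(\<lambda>n. bond_price T (Mn n)) \<longlonglongrightarrow> bond_price T M"
    using bigo_tendsto_0[OF g(3,1)] by (rule LIM_zero_cancel)
  show "(\<lambda>n. digital_price T (Mn n) a) \<longlonglongrightarrow> digital_price T M a" if "isCont (digital_price T M) a"
  proof (cases "a < 0")
    case True
    then show ?thesis using bonds by (simp add: digital_price_neg_strike assms(1-3))
  next
    case False
    then show ?thesis using bigo_tendsto_0[OF g(2) g(1), of a] that by (simp add: LIM_zero_cancel)
  qed
qed

text \<open>\<open>max x 0\<close> continues the payoff constantly to the left of 0, turning
  continuity within \<open>{0..}\<close> into two-sided continuity. The cut can create a new jump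
  only at \<open>a\<close>.\<close>

lemma isCont_truncated_payoff:
  fixes f :: "real \<Rightarrow> real"
  assumes "x \<noteq> a" "0 \<le> x \<Longrightarrow> continuous (at x within {0..}) f"
  shows "isCont (\<lambda>x. if x \<le> a then f (max x 0) else 0) x"
proof -
  have cont: "isCont (\<lambda>x. f (max x 0)) x"
  proof (cases "x < 0")
    case True
    then have "eventually (\<lambda>y. y < 0) (nhds x)" using eventually_nhds_in_open[of "{..<0}" x] by simp
    then have "eventually (\<lambda>y. f (max y 0) = f 0) (nhds x)" by eventually_elim simp
    then show ?thesis by (simp add: isCont_cong)
  next
    case False
    have "isCont (\<lambda>x. max x 0) x" by (intro continuous_intros)
    moreover have "continuous (at (max x 0) within (\<lambda>x. max x 0) ` UNIV) f"
      using assms(2) False by (auto intro: continuous_within_subset)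
    ultimately show ?thesis by (rule continuous_within_compose2)
  qed
  show ?thesis
  proof (cases "x < a")
    case True
    then have "eventually (\<lambda>y. y < a) (nhds x)" using eventually_nhds_in_open[of "{..<a}" x] by simp
    then have "eventually (\<lambda>y. (if y \<le> a then f (max y 0) else 0) = f (max y 0)) (nhds x)"
      by eventually_elim simp
    then show ?thesis using cont by (simp add: isCont_cong)
  next
    case False
    then have "eventually (\<lambda>y. a < y) (nhds x)"
      using eventually_nhds_in_open[of "{a<..}" x] assms(1) by simp
    then have "eventually (\<lambda>y. (if y \<le> a then f (max y 0) else 0) = 0) (nhds x)"
      by eventually_elim simp
    then show ?thesis by (simp add: isCont_cong)
  qed
qed

text \<open>From \<open>r\<close> on, the left limit in \<open>payoff_class_wrt\<close> is the value
  of \<open>f\<close>, and the tail is at most the probability multiplied with it there.\<close>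

lemma payoff_boundary_vanishes:
  assumes "0 < T" "is_model T M" "f \<in> payoff_class_wrt T M"
    and "\<And>u. r \<le> u \<Longrightarrow> isCont f u"
  shows "((\<lambda>b. f b * tail (discounted_law T M) b) \<longlongrightarrow> 0) at_top"
proof (rule Lim_null_comparison)
  show "((\<lambda>x. \<bar>Lim (at_left x) f\<bar> *
      measure (pricing_measure M) {\<omega> \<in> space (pricing_measure M). x \<le> underlying M T \<omega>}) \<longlongrightarrow> 0) at_top"
    using assms(3) by (simp add: payoff_class_wrt_def)
  interpret finite_borel_measure "discounted_law T M"
    by (rule finite_borel_measure_discounted_law[OF assms(1,2)])
  show "eventually (\<lambda>b. norm (f b * tail (discounted_law T M) b) \<le> \<bar>Lim (at_left b) f\<bar> *
      measure (pricing_measure M) {\<omega> \<in> space (pricing_measure M). b \<le> underlying M T \<omega>}) at_top"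
    using eventually_ge_at_top[of r]
  proof eventually_elim
    case (elim b)
    have "(f \<longlongrightarrow> f b) (at_left b)"
      using assms(4)[OF elim] unfolding isCont_def by (rule filterlim_mono) (simp_all add: at_le)
    then have "Lim (at_left b) f = f b" by (intro tendsto_Lim) auto
    then show ?case
      using digital_price_le_prob[OF assms(1,2), of b] tail_nonneg[of b]
      by (auto simp: abs_mult digital_price_eq_tail[OF assms(1,2)] intro!: mult_left_mono)
  qed
qed

text \<open>The common form of both hypotheses of the theorem. Far out, the locale
  \<open>dominated_tail_errors\<close> controls the payoff; on a bounded interval weak convergence
  does; (iii) comes straight from domination.\<close>

lemma dominated_errors_imp_properties:
  fixes T :: real and M :: "'a model" and Mn :: "nat \<Rightarrow> 'b model" and f k :: "real \<Rightarrow> real"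
  assumes T: "0 < T" and M: "is_model T M" and Mn: "\<And>n. is_model T (Mn n)"
    and f: "f \<in> payoff_class_models T M Mn"
    and conv: "models_converge T Mn M"
    and k: "integrable lebesgue k" and g: "g \<longlonglongrightarrow> 0" "\<And>n. g n \<noteq> 0"
    and dominated: "AE a in lebesgue. 0 \<le> a \<longrightarrow>
      (\<forall>n. \<bar>payoff_deriv f a * (digital_price T (Mn n) a - digital_price T M a)\<bar> \<le> \<bar>g n\<bar> * k a)"
  shows "uniformly_integrable_wrt T Mn f \<and> payoff_prices_converge T M Mn f \<and>
         scaled_error_integrals_bounded T M Mn f"
proof -
  let ?L = "discounted_law T M" and ?Ln = "\<lambda>n. discounted_law T (Mn n)"
  have f_class: "f \<in> payoff_class" "f \<in> payoff_class_wrt T M" "\<And>n. f \<in> payoff_class_wrt T (Mn n)"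
    and no_common: "\<And>a. 0 \<le> a \<Longrightarrow> \<not> isCont (digital_price T M) a \<Longrightarrow> continuous (at a within {0..}) f"
    using f by (auto simp: payoff_class_models_def payoff_class_wrt_def)
  have f_int: "integrable (pricing_measure M) (\<lambda>\<omega>. f (underlying M T \<omega>))"
    "\<And>n. integrable (pricing_measure (Mn n)) (\<lambda>\<omega>. f (underlying (Mn n) T \<omega>))"
    using f_class by (auto simp: payoff_class_wrt_def)
  note f_meas = borel_measurable_payoff[OF f_class(1)]

  \<comment> \<open>\<open>k\<close> is only Lebesgue measurable; a Borel function equal to it
    almost everywhere takes its place, and the absolute value makes it nonnegative.\<close>
  obtain h0 where h0: "h0 \<in> borel_measurable lborel" "AE a in lborel. k a = h0 a"
    using completion_ex_borel_measurable_real[OF borel_measurable_integrable[OF k]] by blast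
  define h where "h a = \<bar>h0 a\<bar>" for a
  have "integrable lebesgue h0"
    by (rule integrable_cong_AE_imp[OF k])
       (use h0 in \<open>auto intro: measurable_completion simp: AE_completion_iff\<close>)
  then have h_int: "integrable lborel h"
    unfolding h_def using h0(1) by (simp add: integrable_completion)
  have bound: "AE a in lborel. 0 \<le> a \<longrightarrow>
      (\<forall>n. \<bar>payoff_deriv f a * (tail (?Ln n) a - tail ?L a)\<bar> \<le> \<bar>g n\<bar> * h a)"
    using dominated[unfolded AE_completion_iff] h0(2)
  proof eventually_elim
    case (elim a)
    have "\<bar>g n\<bar> * k a \<le> \<bar>g n\<bar> * h a" for n
      using elim(2) by (intro mult_left_mono) (auto simp: h_def)
    then show ?case
      using elim(1) by (auto simp: digital_price_eq_tail T M Mn intro: order_trans)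
  qed

  obtain r where r: "0 < r" "continuous_on {r..} (payoff_deriv f)"
      "\<And>u. r \<le> u \<Longrightarrow> (f has_real_derivative payoff_deriv f u) (at u)"
    by (rule payoff_eventually_smooth[OF f_class(1)]) blast
  have f_beyond_meas: "(\<lambda>x. indicator {a<..} x * f x) \<in> borel_measurable borel" if "0 \<le> a" for a
  proof -
    have "(\<lambda>x. indicator {a<..} x * (indicator {0..} x * f x)) \<in> borel_measurable borel"
      using f_meas(1) by simp
    moreover have "(\<lambda>x. indicator {a<..} x * (indicator {0..} x * f x)) = (\<lambda>x. indicator {a<..} x * f x)"
      using that by (auto simp: indicator_def)
    ultimately show ?thesis by simp
  qed
  have f_beyond_int: "integrable ?L (\<lambda>x. indicator {a<..} x * f x)"
    "integrable (?Ln n) (\<lambda>x. indicator {a<..} x * f x)" if "0 \<le> a" for a n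
    by (rule integrable_discounted_law[OF _ _ f_beyond_meas[OF that] _ f_int(1)]
          integrable_discounted_law[OF _ _ f_beyond_meas[OF that] _ f_int(2)];
        use T M Mn in \<open>auto simp: indicator_def\<close>)+
  interpret dominated_tail_errors ?L ?Ln f "payoff_deriv f" h g r
  proof (rule dominated_tail_errors.intro)
    show "finite_borel_measure ?L" "finite_borel_measure (?Ln n)" for n
      using T M Mn by (auto intro: finite_borel_measure_discounted_law)
    show "((\<lambda>b. f b * tail ?L b) \<longlongrightarrow> 0) at_top" "((\<lambda>b. f b * tail (?Ln n) b) \<longlongrightarrow> 0) at_top" for n
      using T M Mn f_class r(3) by (auto intro!: payoff_boundary_vanishes[where r=r] DERIV_isCont)
    show "AE u in lborel. r \<le> u \<longrightarrow>
        (\<forall>n. \<bar>payoff_deriv f u * (tail (?Ln n) u - tail ?L u)\<bar> \<le> \<bar>g n\<bar> * h u)"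
      using bound by eventually_elim (use r(1) in auto)
    show "(\<lambda>n. tail (?Ln n) a) \<longlonglongrightarrow> tail ?L a" if "isCont (tail ?L) a" for a
      using digital_and_bond_prices_tendsto(2)[OF T M Mn conv, of a] that by (simp add: digital_price_eq_tail T M Mn)
  qed (use r f_beyond_int h_int g in \<open>auto simp: h_def\<close>)

  have beyond_eq: "expect_discounted T K (\<lambda>x. f x * indicator {a<..} x) = beyond (discounted_law T K) a"
    if "is_model T K" "0 \<le> a" for K :: "'c model" and a
    unfolding beyond_def using that T f_beyond_meas
    by (intro expect_discounted_eq_integral) (auto simp: mult.commute)

  have "uniformly_integrable_wrt T Mn f"
    unfolding uniformly_integrable_wrt_def
  proof (intro allI impI)
    fix \<epsilon> :: real assume "0 < \<epsilon>"
    \<comment> \<open>Half of \<epsilon> is used because a supremum of terms below \<epsilon> may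
      equal \<epsilon>.\<close>
    then obtain a where a: "r \<le> a" "\<And>n. \<bar>beyond (?Ln n) a\<bar> \<le> \<epsilon> / 2"
      using ex_beyond_uniformly_small[of "\<epsilon> / 2"] by auto
    have "(SUP n. ereal \<bar>expect_discounted T (Mn n) (\<lambda>x. f x * indicator {a<..} x)\<bar>) \<le> ereal (\<epsilon> / 2)"
      using a r(1) Mn by (intro SUP_least) (simp add: beyond_eq)
    also have "\<dots> < ereal \<epsilon>" using \<open>0 < \<epsilon>\<close> by simp
    finally show "\<exists>a. (SUP n. ereal \<bar>expect_discounted T (Mn n) (\<lambda>x. f x * indicator {a<..} x)\<bar>) < ereal \<epsilon>"
      by blast
  qed

  moreover have "payoff_prices_converge T M Mn f"
  proof -
    \<comment> \<open>At a continuity point the cut of \<phi> meets no atom, and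
      \<open>beyond_tendsto\<close> applies.\<close>
    obtain a where a: "r < a" "isCont (tail ?L) a"
      using M.ex_continuity_point_tail[of r "r + 1"] by auto
    define \<phi> where "\<phi> x = (if x \<le> a then f (max x 0) else 0)" for x
    have \<phi>_meas: "\<phi> \<in> borel_measurable borel"
    proof -
      have "(\<lambda>x. indicator {0..} (max x 0) * f (max x 0)) \<in> borel_measurable borel"
        by (rule measurable_compose[OF _ f_meas(1)]) simp
      then have "(\<lambda>x. f (max x 0)) \<in> borel_measurable borel" by simp
      then show ?thesis unfolding \<phi>_def by measurable
    qed
    obtain C where C: "\<And>x. 0 \<le> x \<Longrightarrow> x \<le> a \<Longrightarrow> \<bar>f x\<bar> \<le> C"
      by (rule payoff_bounded_on_compact[OF f_class(1)]) blast
    have \<phi>_bdd: "\<bar>\<phi> x\<bar> \<le> C" for x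
      using C[of "max x 0"] C[of 0] a(1) r(1) by (auto simp: \<phi>_def)
    have price_split: "payoff_price T K f = (\<integral>x. \<phi> x \<partial>discounted_law T K) + beyond (discounted_law T K) a"
      if K: "is_model T K" and int: "integrable (pricing_measure K) (\<lambda>\<omega>. f (underlying K T \<omega>))"
      for K :: "'c model"
    proof -
      have "payoff_price T K f = (\<integral>x. \<phi> x + indicator {a<..} x * f x \<partial>discounted_law T K)"
        using a(1) r(1)
        by (intro expect_discounted_eq_integral[OF T K borel_measurable_add[OF \<phi>_meas f_beyond_meas]])
           (auto simp: \<phi>_def indicator_def)
      also have "\<dots> = (\<integral>x. \<phi> x \<partial>discounted_law T K) + (\<integral>x. indicator {a<..} x * f x \<partial>discounted_law T K)"
      proof (rule Bochner_Integration.integral_add)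
        show "integrable (discounted_law T K) \<phi>"
          by (rule integrable_discounted_law[OF T K \<phi>_meas _ int]) (auto simp: \<phi>_def)
        show "integrable (discounted_law T K) (\<lambda>x. indicator {a<..} x * f x)"
          using a(1) r(1)
          by (intro integrable_discounted_law[OF T K f_beyond_meas _ int]) (auto simp: indicator_def)
      qed
      finally show ?thesis by (simp add: beyond_def)
    qed
    have "measure ?L {x. \<not> isCont \<phi> x} = 0"
    proof -
      let ?D = "{x. \<not> isCont \<phi> x}"
      have "?D \<subseteq> insert a {x. 0 \<le> x \<and> \<not> continuous (at x within {0..}) f}"
        using isCont_truncated_payoff unfolding \<phi>_def by blast
      then have fin: "finite ?D"
        using payoff_class_finite_discontinuities[OF f_class(1)] finite_subset by blast
      \<comment> \<open>No discontinuity of \<phi> is an atom: an atom differs from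
        \<open>a\<close>, is nonnegative, and by \<open>no_common\<close> is a continuity point of
        \<open>f\<close>, hence of \<phi>. As \<open>?D\<close> is finite, its measure is then
        zero.\<close>
      have "isCont (tail ?L) x" if x: "x \<in> ?D" for x
      proof (rule ccontr)
        assume jump: "\<not> isCont (tail ?L) x"
        then have "x \<noteq> a" using a(2) by auto
        moreover have "0 \<le> x"
          using jump isCont_digital_price_neg_strike[OF T M, of x]
          by (force simp: digital_price_eq_tail T M)
        then have "continuous (at x within {0..}) f"
          using no_common jump by (simp add: digital_price_eq_tail T M)
        ultimately show False
          using x isCont_truncated_payoff[of x a f] by (simp add: \<phi>_def[abs_def])
      qed
      then show ?thesis
        using M.finite_measure_eq_sum_singleton[OF fin]
        by (simp add: M.M_is_borel M.isCont_tail_iff_no_atom)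
    qed
    then have "(\<lambda>n. \<integral>x. \<phi> x \<partial>?Ln n) \<longlonglongrightarrow> (\<integral>x. \<phi> x \<partial>?L)"
      using bond_price_pos[OF T M] bond_price_pos[OF T Mn] digital_and_bond_prices_tendsto[OF T M Mn conv] \<phi>_meas \<phi>_bdd
      by (intro tendsto_integral_of_tails[where C=C] M_finite N_finite)
         (simp_all add: bond_price_eq_total digital_price_eq_tail T M Mn)
    then have "(\<lambda>n. (\<integral>x. \<phi> x \<partial>?Ln n) + beyond (?Ln n) a) \<longlonglongrightarrow> (\<integral>x. \<phi> x \<partial>?L) + beyond ?L a"
      using a by (intro tendsto_add beyond_tendsto) auto
    then have "(\<lambda>n. payoff_price T (Mn n) f) \<longlonglongrightarrow> payoff_price T M f"
      by (simp add: price_split M Mn f_int)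
    then have "(\<lambda>n. payoff_price T (Mn n) f - payoff_price T M f) \<longlonglongrightarrow> 0"
      by (rule LIM_zero)
    \<comment> \<open>The price error itself is the rate.\<close>
    then show ?thesis
      unfolding payoff_prices_converge_def using landau_o.big_refl by (intro exI conjI)
  qed

  moreover have "scaled_error_integrals_bounded T M Mn f"
  proof -
    let ?e = "\<lambda>n a. payoff_deriv f a * (digital_price T (Mn n) a - digital_price T M a) * inverse (g n)"
    have e_le: "AE a in lborel. norm (indicator {0..} a *\<^sub>R ?e n a) \<le> h a" for n
      using bound
    proof eventually_elim
      case (elim a)
      show ?case
      proof (cases "0 \<le> a")
        case True
        then have "\<bar>payoff_deriv f a * (tail (?Ln n) a - tail ?L a)\<bar> \<le> \<bar>g n\<bar> * h a"
          using elim by simp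
        then have "\<bar>payoff_deriv f a * (tail (?Ln n) a - tail ?L a)\<bar> / \<bar>g n\<bar> \<le> h a"
          using g(2)[of n] by (simp add: divide_le_eq mult.commute)
        then show ?thesis
          using True by (simp add: digital_price_eq_tail T M Mn abs_mult abs_inverse divide_inverse)
      qed (simp add: h_def)
    qed
    have e_meas: "(\<lambda>a. indicator {0..} a *\<^sub>R ?e n a) \<in> borel_measurable lborel" for n
    proof -
      note [measurable] = f_meas(2) M.borel_measurable_tail N.borel_measurable_tail
      have "(\<lambda>a. (indicator {0..} a * payoff_deriv f a) * (tail (?Ln n) a - tail ?L a) * inverse (g n))
          \<in> borel_measurable borel"
        by measurable
      then show ?thesis by (simp add: digital_price_eq_tail T M Mn mult.assoc)
    qed
    have e_int: "set_integrable lborel {0..} (?e n)" for n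
      unfolding set_integrable_def
      by (rule Bochner_Integration.integrable_bound[OF h_int e_meas]) (use e_le[of n] in \<open>simp add: h_def\<close>)
    \<comment> \<open>By absolute integrability the Henstock-Kurzweil integral is the Lebesgue
      integral, so \<open>h\<close> bounds it uniformly in \<open>n\<close>.\<close>
    have "\<bar>integral {0..} (?e n)\<bar> \<le> (\<integral>a. h a \<partial>lborel)" for n
    proof -
      have "\<bar>integral {0..} (?e n)\<bar> = norm (\<integral>a. indicator {0..} a *\<^sub>R ?e n a \<partial>lborel)"
        using set_borel_integral_eq_integral(2)[OF e_int[of n]]
        unfolding set_lebesgue_integral_def by (simp only: real_norm_def)
      also have "\<dots> \<le> (\<integral>a. h a \<partial>lborel)"
        using e_int[of n] h_int e_le[of n]
        by (intro order_trans[OF integral_norm_bound] integral_mono_AE integrable_norm)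
           (auto simp: set_integrable_def)
      finally show ?thesis .
    qed
    then have "(SUP n. ereal \<bar>integral {0..} (?e n)\<bar>) \<le> ereal (\<integral>a. h a \<partial>lborel)"
      by (intro SUP_least) simp
    then have "(SUP n. ereal \<bar>integral {0..} (?e n)\<bar>) < \<infinity>"
      by (rule order_le_less_trans) simp
    then show ?thesis
      unfolding scaled_error_integrals_bounded_def Let_def
      by (intro exI[of _ g] conjI allI g set_borel_integral_eq_integral(1)[OF e_int])
  qed
  ultimately show ?thesis by blast
qed

text \<open>Either hypothesis gives an almost everywhere bound by \<open>\<bar>g n\<bar>\<close>
  times an integrable function: the real-valued supremum in (1), a constant multiple of
  \<open>\<bar>h\<bar>\<close> in (2).\<close>

theorem corollary2p2:
  fixes T :: real and M :: "'a model" and Mn :: "nat \<Rightarrow> 'b model" and f :: "real \<Rightarrow> real"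
  assumes "T > 0"
    and "is_model T M"
    and "\<And>n. is_model T (Mn n)"
    and "f \<in> payoff_class_models T M Mn"
    and "models_converge T Mn M"
  shows
    "((\<exists>g :: nat \<Rightarrow> real. g \<longlonglongrightarrow> 0 \<and> (\<forall>n. g n \<noteq> 0) \<and>
        L1_halfline (\<lambda>a. SUP n. ennreal \<bar>payoff_deriv f a
          * (digital_price T (Mn n) a - digital_price T M a) * inverse (g n)\<bar>))
     \<longrightarrow> uniformly_integrable_wrt T Mn f \<and> payoff_prices_converge T M Mn f \<and>
         scaled_error_integrals_bounded T M Mn f)
     \<and>
     ((\<exists>(\<Upsilon> :: real set) (h :: real \<Rightarrow> real) (g :: nat \<Rightarrow> real).
        \<Upsilon> \<in> null_sets lebesgue \<and> set_integrable lebesgue {0..} h \<and>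
        g \<longlonglongrightarrow> 0 \<and> (\<forall>n. g n \<noteq> 0) \<and> (\<forall>a \<in> {0..} - \<Upsilon>. h a \<noteq> 0) \<and>
        (SUP n. SUP a\<in>{0..} - \<Upsilon>. ennreal \<bar>inverse (h a) * payoff_deriv f a
          * (digital_price T (Mn n) a - digital_price T M a) * inverse (g n)\<bar>) < \<infinity>)
     \<longrightarrow> uniformly_integrable_wrt T Mn f \<and> payoff_prices_converge T M Mn f \<and>
         scaled_error_integrals_bounded T M Mn f)"
proof (rule conjI; rule impI; elim exE conjE)
  let ?d = "\<lambda>n a. payoff_deriv f a * (digital_price T (Mn n) a - digital_price T M a)"
  let ?goal = "uniformly_integrable_wrt T Mn f \<and> payoff_prices_converge T M Mn f \<and>
         scaled_error_integrals_bounded T M Mn f"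
  show ?goal
    if "g \<longlonglongrightarrow> 0" "\<forall>n. g n \<noteq> 0" and L1: "L1_halfline (\<lambda>a. SUP n. ennreal \<bar>?d n a * inverse (g n)\<bar>)" for g
  proof -
    \<comment> \<open>Extending by 0 turns measurability and integrability on the half-line into the
      same on the whole line.\<close>
    define H where "H a = (SUP n. ennreal \<bar>?d n a * inverse (g n)\<bar>) * indicator {0..} a" for a
    have H_meas: "H \<in> borel_measurable lebesgue" and H_fin: "(\<integral>\<^sup>+a. H a \<partial>lebesgue) < \<infinity>"
      using L1 unfolding L1_halfline_def H_def by (auto simp: borel_measurable_restrict_space_iff_ennreal)
    show ?thesis
    proof (rule dominated_errors_imp_properties[OF assms, where k="\<lambda>a. enn2real (H a)" and g=g])
      show "integrable lebesgue (\<lambda>a. enn2real (H a))"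
      proof (rule integrableI_bounded)
        show "(\<lambda>a. enn2real (H a)) \<in> borel_measurable lebesgue" using H_meas by simp
        have "(\<integral>\<^sup>+a. ennreal (norm (enn2real (H a))) \<partial>lebesgue) \<le> (\<integral>\<^sup>+a. H a \<partial>lebesgue)"
          by (intro nn_integral_mono) (simp add: ennreal_enn2real_if)
        then show "(\<integral>\<^sup>+a. ennreal (norm (enn2real (H a))) \<partial>lebesgue) < \<infinity>"
          using H_fin by (rule order_le_less_trans)
      qed
      \<comment> \<open>\<open>enn2real\<close> sends \<infinity> to 0, so the pointwise bound could
        fail where \<open>H\<close> is infinite; a finite integral makes that set null.\<close>
      have "AE a in lebesgue. H a \<noteq> \<infinity>"
        using H_fin H_meas by (intro nn_integral_PInf_AE) auto
      then show "AE a in lebesgue. 0 \<le> a \<longrightarrow> (\<forall>n. \<bar>?d n a\<bar> \<le> \<bar>g n\<bar> * enn2real (H a))"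
      proof eventually_elim
        case (elim a)
        show ?case
        proof (intro impI allI)
          fix n assume "0 \<le> a"
          then have "ennreal \<bar>?d n a * inverse (g n)\<bar> \<le> H a"
            unfolding H_def by (auto intro: SUP_upper)
          also have "H a = ennreal (enn2real (H a))" using elim by (simp add: less_top)
          finally have "\<bar>?d n a * inverse (g n)\<bar> \<le> enn2real (H a)" by simp
          then have "\<bar>g n\<bar> * \<bar>?d n a * inverse (g n)\<bar> \<le> \<bar>g n\<bar> * enn2real (H a)"
            by (rule mult_left_mono) simp
          moreover have "\<bar>g n\<bar> * \<bar>?d n a * inverse (g n)\<bar> = \<bar>?d n a\<bar>"
            using that(2) by (simp add: abs_mult abs_inverse)
          ultimately show "\<bar>?d n a\<bar> \<le> \<bar>g n\<bar> * enn2real (H a)" by simp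
        qed
      qed
    qed (use that in auto)
  qed
  show ?goal
    if null: "\<Upsilon> \<in> null_sets lebesgue" and h: "set_integrable lebesgue {0..} h"
      and g: "g \<longlonglongrightarrow> 0" "\<forall>n. g n \<noteq> 0" and h_nz: "\<forall>a \<in> {0..} - \<Upsilon>. h a \<noteq> 0"
      and fin: "(SUP n. SUP a\<in>{0..} - \<Upsilon>. ennreal \<bar>inverse (h a) * payoff_deriv f a
          * (digital_price T (Mn n) a - digital_price T M a) * inverse (g n)\<bar>) < \<infinity>" for \<Upsilon> h g
  proof -
    define S where "S = (SUP n. SUP a\<in>{0..} - \<Upsilon>. ennreal \<bar>inverse (h a) * payoff_deriv f a
          * (digital_price T (Mn n) a - digital_price T M a) * inverse (g n)\<bar>)"
    \<comment> \<open>\<open>S\<close> is finite, so \<open>enn2real\<close> loses nothing. As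
      \<open>h\<close> may take either sign, the dominating function below uses its absolute
      value.\<close>
    define C where "C = enn2real S"
    have C_nonneg: "0 \<le> C" by (simp add: C_def)
    have S_eq: "S = ennreal C" using fin by (simp add: C_def S_def)
    show ?thesis
    proof (rule dominated_errors_imp_properties[OF assms, where k="\<lambda>a. C * \<bar>indicator {0..} a *\<^sub>R h a\<bar>" and g=g])
      show "integrable lebesgue (\<lambda>a. C * \<bar>indicator {0..} a *\<^sub>R h a\<bar>)"
        using h unfolding set_integrable_def by (intro integrable_mult_right integrable_abs)
      show "AE a in lebesgue. 0 \<le> a \<longrightarrow> (\<forall>n. \<bar>?d n a\<bar> \<le> \<bar>g n\<bar> * (C * \<bar>indicator {0..} a *\<^sub>R h a\<bar>))"
        using AE_not_in[OF null]
      proof eventually_elim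
        case (elim a)
        show ?case
        proof (intro impI allI)
          fix n assume a: "0 \<le> a"
          have "ennreal \<bar>inverse (h a) * payoff_deriv f a
              * (digital_price T (Mn n) a - digital_price T M a) * inverse (g n)\<bar> \<le> S"
            unfolding S_def
            by (intro SUP_upper2[where i=n] SUP_upper2[where i=a] UNIV_I order_refl) (use a elim in simp)
          then have "\<bar>inverse (h a) * ?d n a * inverse (g n)\<bar> \<le> C"
            using C_nonneg by (simp add: S_eq mult.assoc)
          then have "\<bar>g n\<bar> * \<bar>h a\<bar> * \<bar>inverse (h a) * ?d n a * inverse (g n)\<bar> \<le> \<bar>g n\<bar> * \<bar>h a\<bar> * C"
            by (rule mult_left_mono) simp
          moreover have "\<bar>g n\<bar> * \<bar>h a\<bar> * \<bar>inverse (h a) * ?d n a * inverse (g n)\<bar> = \<bar>?d n a\<bar>"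
          proof -
            have "g n \<noteq> 0" "h a \<noteq> 0" using g(2) h_nz a elim by auto
            then show ?thesis by (simp add: abs_mult field_simps)
          qed
          ultimately show "\<bar>?d n a\<bar> \<le> \<bar>g n\<bar> * (C * \<bar>indicator {0..} a *\<^sub>R h a\<bar>)"
            using a by (simp add: mult.commute mult.left_commute)
        qed
      qed
    qed (use g in auto)
  qed
qed

end
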